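(* Let $k>2$ be an integer. Then every minimal $k$-interval exchange transformation has at most $k-2$ generic measures.
   Context: Let $k\ge1$ be an integer, $\pi$ a permutation of $\{1,\dots,k\}$, and $0=\lambda_0<\lambda_1<\dots<\lambda_k=\lambda$. The associated $k$-interval exchange transformation ($k$-IET) is the bijection $T\colon[0,\lambda)\to[0,\lambda)$ that is a translation on each subinterval $[\lambda_{i-1},\lambda_i)$, $i=1,\dots,k$, and rearranges the order of these subintervals according to $\pi$; explicitly, for $x\in[\lambda_{i-1},\lambda_i)$, $$T(x)=x-\lambda_{i-1}+\sum_{j\colon\pi(j)<\pi(i)}(\lambda_j-\lambda_{j-1}).$$ $T$ is minimal if every orbit $\{T^n x\colon n\in\mathbb{Z}\}$ is dense in $[0,\lambda)$. Let $\mu$ be a $T$-invariant Borel probability measure. A point $x$ is generic for $\mu$ if for every continuous $f\colon[0,\lambda]\to\mathbb{R}$, $$\lim_{N\to\infty}\frac1N\sum_{n=0}^{N-1}f(T^n x)=\int f\,d\mu.$$ The measure $\mu$ is called generic if it has a generic point. A generic measure need not be ergodic. *)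

theory Defs
  imports "HOL-Probability.Probability" "HOL-Combinatorics.Permutations"
begin

definition iet_data :: "nat \<Rightarrow> (nat \<Rightarrow> nat) \<Rightarrow> (nat \<Rightarrow> real) \<Rightarrow> bool" where
  "iet_data k \<pi> l \<longleftrightarrow>
     1 \<le> k \<and> \<pi> permutes {1..k} \<and> l 0 = 0 \<and> strict_mono_on {0..k} l"

definition iet_index :: "nat \<Rightarrow> (nat \<Rightarrow> real) \<Rightarrow> real \<Rightarrow> nat" where
  "iet_index k l x = (THE i. i \<in> {1..k} \<and> x \<in> {l (i - 1)..<l i})"

text \<open>The interval exchange is a self-map of \<open>[0, l k)\<close>; outside this interval the function
  below takes unspecified values, which none of the later definitions look at.\<close>

definition iet :: "nat \<Rightarrow> (nat \<Rightarrow> nat) \<Rightarrow> (nat \<Rightarrow> real) \<Rightarrow> real \<Rightarrow> real" where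
  "iet k \<pi> l x =
     (let i = iet_index k l x
      in x - l (i - 1) + (\<Sum>j | j \<in> {1..k} \<and> \<pi> j < \<pi> i. l j - l (j - 1)))"

lemma iet_eq:
  assumes "iet_data k \<pi> l" "i \<in> {1..k}" "x \<in> {l (i - 1)..<l i}"
  shows "iet k \<pi> l x = x - l (i - 1) + (\<Sum>j | j \<in> {1..k} \<and> \<pi> j < \<pi> i. l j - l (j - 1))"
proof -
  have mono: "l a \<le> l b" if "a \<le> b" "b \<le> k" for a b
    using assms(1) that unfolding iet_data_def
    by (auto dest!: strict_mono_on_imp_mono_on intro: mono_onD)
  have "i' = i" if "i' \<in> {1..k}" "x \<in> {l (i' - 1)..<l i'}" for i'
  proof (rule ccontr)
    assume "i' \<noteq> i"
    then consider "i' \<le> i - 1" | "i \<le> i' - 1" by linarith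
    then show False
    proof cases
      case 1
      then have "l i' \<le> l (i - 1)" using mono assms(2) by auto
      then show False using that assms(3) by auto
    next
      case 2
      then have "l i \<le> l (i' - 1)" using mono that by auto
      then show False using that assms(3) by auto
    qed
  qed
  then have "iet_index k l x = i"
    unfolding iet_index_def using assms(2,3) by blast
  then show ?thesis by (simp add: iet_def)
qed

definition full_orbit :: "'a set \<Rightarrow> ('a \<Rightarrow> 'a) \<Rightarrow> 'a \<Rightarrow> 'a set" where
  "full_orbit X T x = range (\<lambda>n. (T ^^ n) x) \<union> range (\<lambda>n. (inv_into X T ^^ n) x)"

definition minimal_iet :: "nat \<Rightarrow> (nat \<Rightarrow> nat) \<Rightarrow> (nat \<Rightarrow> real) \<Rightarrow> bool" where
  "minimal_iet k \<pi> l \<longleftrightarrow>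
     iet_data k \<pi> l \<and>
     (\<forall>x\<in>{0..<l k}. {0..<l k} \<subseteq> closure (full_orbit {0..<l k} (iet k \<pi> l) x))"

definition invariant_measure :: "real \<Rightarrow> (real \<Rightarrow> real) \<Rightarrow> real measure \<Rightarrow> bool" where
  "invariant_measure L T \<mu> \<longleftrightarrow>
     prob_space \<mu> \<and> sets \<mu> = sets (restrict_space borel {0..<L}) \<and>
     T \<in> \<mu> \<rightarrow>\<^sub>M \<mu> \<and> distr \<mu> \<mu> T = \<mu>"

text \<open>Test functions are continuous on the closed interval \<open>[0, L]\<close>, although the
  measures live on \<open>[0, L)\<close>.\<close>

definition generic_point :: "real \<Rightarrow> (real \<Rightarrow> real) \<Rightarrow> real measure \<Rightarrow> real \<Rightarrow> bool" where
  "generic_point L T \<mu> x \<longleftrightarrow>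
     x \<in> {0..<L} \<and>
     (\<forall>f :: real \<Rightarrow> real. continuous_on {0..L} f \<longrightarrow>
        (\<lambda>N. (1 / real N) * (\<Sum>n<N. f ((T ^^ n) x))) \<longlonglongrightarrow> (\<integral>y. f y \<partial>\<mu>))"

definition generic_measure :: "real \<Rightarrow> (real \<Rightarrow> real) \<Rightarrow> real measure \<Rightarrow> bool" where
  "generic_measure L T \<mu> \<longleftrightarrow> invariant_measure L T \<mu> \<and> (\<exists>x. generic_point L T \<mu> x)"

end

theory Submission
  imports Defs
begin

text \<open>Code points by their itineraries through the \<open>k\<close> exchanged intervals. There are at most
  \<open>(k - 1) * n + 1\<close> words of length \<open>n\<close>, and every right special word of length \<open>n\<close> is the
  \<open>n\<close>-step past of one of the \<open>k - 1\<close> interior endpoints.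

  Suppose that \<open>k - 1\<close> distinct measures have generic points. A single continuous function tells
  the measures apart, and since long cylinders are short intervals, its Birkhoff sums along a
  generic point are read off from words. Every generic point meets a right special word of length
  \<open>n\<close> within linear time, so for large \<open>n\<close> the right special words correspond bijectively to the
  measures. A path in the Rauzy graph between right special words of different measures has length
  almost \<open>n\<close>, because overlapping words would have comparable Birkhoff sums. By
  connectedness, each of the \<open>k - 1\<close> right special words starts such a path, and these paths
  use up almost all the vertices. Hence the other branch at a right special word closes up or merges
  after few steps, which makes the word almost periodic with a period that is small compared to \<open>n\<close>.
  This holds at every scale, so the whole past of an interior endpoint is periodic, which
  contradicts minimality.\<close>

section \<open>Continuous test functions, Birkhoff averages and periods of sequences\<close>

text \<open>For each \<open>y > x\<close> the integral of \<open>cts_step x y\<close> lies between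
  \<open>cdf M x\<close> and \<open>cdf N y\<close>; right continuity then lets \<open>y\<close>
  decrease to \<open>x\<close>.\<close>

lemma cdf_le_if_cts_step_eq:
  assumes M: "real_distribution M" and N: "real_distribution N"
    and eq: "\<And>x y. x < y \<Longrightarrow> integral\<^sup>L M (cts_step x y) = integral\<^sup>L N (cts_step x y)"
  shows "cdf M x \<le> cdf N x"
proof (rule tendsto_lowerbound)
  interpret N: real_distribution N by fact
  show "(cdf N \<longlongrightarrow> cdf N x) (at_right x)"
    using N.cdf_is_right_cont[of x] by (simp add: continuous_within)
  have "cdf M x \<le> cdf N y" if "x < y" for y
    using real_distribution.cdf_cts_step(1)[OF M that] N.cdf_cts_step(2)[OF that] eq[OF that] by linarith
  then show "\<forall>\<^sub>F y in at_right x. cdf M x \<le> cdf N y"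
    by (auto simp: eventually_at_filter)
qed simp

lemma prob_eqI_continuous:
  fixes \<mu> \<nu> :: "real measure"
  assumes prob: "prob_space \<mu>" "prob_space \<nu>"
    and sets: "sets \<mu> = sets (restrict_space borel {0..<L})" "sets \<nu> = sets (restrict_space borel {0..<L})"
    and eq: "\<And>f :: real \<Rightarrow> real. continuous_on {0..L} f \<Longrightarrow> integral\<^sup>L \<mu> f = integral\<^sup>L \<nu> f"
  shows "\<mu> = \<nu>"
proof -
  \<comment> \<open>Pushing forward along the inclusion turns the measures on \<open>{0..<L}\<close>
    into distributions on the whole line, where the uniqueness theorem for cdfs applies.\<close>
  define E where "E m = distr m borel (\<lambda>x :: real. x)" for m
  have meas: "(\<lambda>x. x) \<in> borel_measurable m" if "sets m = sets (restrict_space borel {0..<L})" for m :: "real measure"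
    unfolding measurable_cong_sets[OF that refl] by (rule measurable_restrict_space1) simp
  have E: "real_distribution (E m)" if "prob_space m" "sets m = sets (restrict_space borel {0..<L})" for m
    unfolding E_def by (rule prob_space.real_distribution_distr[OF that(1) meas[OF that(2)]])
  have int: "integral\<^sup>L (E m) f = integral\<^sup>L m f"
    if "sets m = sets (restrict_space borel {0..<L})" "continuous_on UNIV f" for m and f :: "real \<Rightarrow> real"
    unfolding E_def using that(2) by (intro integral_distr meas[OF that(1)] borel_measurable_continuous_onI)
  have step: "integral\<^sup>L (E \<mu>) (cts_step x y) = integral\<^sup>L (E \<nu>) (cts_step x y)" if "x < y" for x y
  proof -
    have c: "continuous_on UNIV (cts_step x y)"
      by (rule uniformly_continuous_imp_continuous[OF cts_step_uniformly_continuous[OF that]])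
    show ?thesis
      unfolding int[OF sets(1) c] int[OF sets(2) c] by (rule eq[OF continuous_on_subset[OF c]]) simp
  qed
  have "cdf (E \<mu>) = cdf (E \<nu>)"
    using cdf_le_if_cts_step_eq[OF E[OF prob(1) sets(1)] E[OF prob(2) sets(2)] step]
      cdf_le_if_cts_step_eq[OF E[OF prob(2) sets(2)] E[OF prob(1) sets(1)] step[symmetric]]
    by (intro ext antisym)
  then have EE: "E \<mu> = E \<nu>"
    by (rule cdf_unique[OF E[OF prob(1) sets(1)] E[OF prob(2) sets(2)]])
  have em: "emeasure m A = emeasure (E m) A"
    if "sets m = sets (restrict_space borel {0..<L})" "A \<in> sets m" for m A
  proof -
    have sp: "space m = {0..<L}" using sets_eq_imp_space_eq[OF that(1)] by (simp add: space_restrict_space)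
    have "A \<subseteq> {0..<L}" "A \<in> sets borel"
      using that by (auto simp: sets_restrict_space)
    then show ?thesis
      unfolding E_def by (subst emeasure_distr[OF meas[OF that(1)]]) (auto simp: sp intro: arg_cong[where f = "emeasure m"])
  qed
  show ?thesis
    by (rule measure_eqI) (use sets em EE in auto)
qed

text \<open>Induction on \<open>I\<close>: if \<open>f\<close> fails to separate the new index from
  the old ones, it is perturbed by \<open>t * g\<close>, and only finitely many \<open>t\<close>
  create a coincidence.\<close>

lemma ex_separating_function:
  fixes A :: "'i \<Rightarrow> ('a \<Rightarrow> real) \<Rightarrow> real"
  assumes I: "finite I"
    and zero: "(\<lambda>_. 0) \<in> V"
    and comb: "\<And>f g t. f \<in> V \<Longrightarrow> g \<in> V \<Longrightarrow> (\<lambda>x. f x + t * g x) \<in> V"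
    and linear: "\<And>i f g t. i \<in> I \<Longrightarrow> f \<in> V \<Longrightarrow> g \<in> V \<Longrightarrow> A i (\<lambda>x. f x + t * g x) = A i f + t * A i g"
    and sep: "\<And>i j. i \<in> I \<Longrightarrow> j \<in> I \<Longrightarrow> i \<noteq> j \<Longrightarrow> \<exists>f\<in>V. A i f \<noteq> A j f"
  shows "\<exists>f\<in>V. inj_on (\<lambda>i. A i f) I"
  using I linear sep
proof (induction I rule: finite_induct)
  case empty
  then show ?case using zero by auto
next
  case (insert i I)
  then obtain f where f: "f \<in> V" "inj_on (\<lambda>i. A i f) I" by auto
  show ?case
  proof (cases "\<exists>j\<in>I. A j f = A i f")
    case False
    then have "inj_on (\<lambda>i. A i f) (insert i I)" using f(2) by (auto simp: inj_on_def)
    then show ?thesis using f(1) by blast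
  next
    case True
    \<comment> \<open>As \<open>f\<close> is injective on \<open>I\<close>, this \<open>j\<close> is
      the only index that collides with \<open>i\<close>, so \<open>g\<close> has to separate just
      this pair.\<close>
    then obtain j where j: "j \<in> I" "A j f = A i f" by blast
    then have "i \<noteq> j" using insert.hyps by auto
    then obtain g where g: "g \<in> V" "A i g \<noteq> A j g" using insert.prems(2)[of i j] j by auto
    \<comment> \<open>The quotient is the only \<open>t\<close> at which \<open>p\<close> and
      \<open>q\<close> can coincide when \<open>g\<close> separates them. The other pairs merely add
      the value 0 of a division by zero; they are treated separately below.\<close>
    define bad where "bad = (\<lambda>(p, q). (A q f - A p f) / (A p g - A q g)) ` (insert i I \<times> insert i I)"
    have "finite bad" unfolding bad_def using insert.hyps by simp
    then obtain t where t: "t \<notin> bad" using ex_new_if_finite[OF infinite_UNIV_char_0] by blast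
    have "p = q" if pq: "p \<in> insert i I" "q \<in> insert i I"
      "A p f + t * A p g = A q f + t * A q g" for p q
    proof (rule ccontr)
      assume ne: "p \<noteq> q"
      show False
      proof (cases "A p g = A q g")
        case False
        then have "t = (A q f - A p f) / (A p g - A q g)" using pq(3) by (simp add: field_simps)
        then have "t \<in> bad" unfolding bad_def using pq(1,2) by (intro image_eqI[of _ _ "(p, q)"]) auto
        then show False using t by simp
      next
        case True
        then have eq: "A p f = A q f" using pq(3) by simp
        consider "p \<in> I" "q \<in> I" | "p = i" "q \<in> I" | "q = i" "p \<in> I" using pq ne by auto
        then show False
        proof cases
          case 1
          then show False using f(2) eq ne by (auto dest: inj_onD)
        next
          case 2
          then have "q = j" using inj_onD[OF f(2), of q j] eq j by simp
          then show False using True g 2 by simp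
        next
          case 3
          then have "p = j" using inj_onD[OF f(2), of p j] eq j by simp
          then show False using True g 3 by simp
        qed
      qed
    qed
    then have "inj_on (\<lambda>i. A i (\<lambda>x. f x + t * g x)) (insert i I)"
      using insert.prems(1)[OF _ f(1) g(1)] by (intro inj_onI) simp
    then show ?thesis using comb[OF f(1) g(1)] by blast
  qed
qed

text \<open>A segment sum is the difference of two initial sums, and each of these deviates by
  \<open>o(n)\<close>, uniformly for endpoints up to \<open>C * n\<close>. Thus the segment may
  start anywhere in a linear time window.\<close>

lemma average_segments:
  fixes u :: "nat \<Rightarrow> real"
  assumes lim: "(\<lambda>N. (1 / real N) * (\<Sum>n<N. u n)) \<longlonglongrightarrow> a" and e: "e > 0"
  shows "\<exists>n0. \<forall>n\<ge>n0. \<forall>p q. p \<le> q \<longrightarrow> q \<le> C * n \<longrightarrow> \<bar>\<Sum>j=p..<q. u j - a\<bar> \<le> e * real n"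
proof -
  define G where "G m = (\<Sum>j<m. u j - a)" for m
  define d where "d = e / (4 * (real C + 1))"
  have d: "d > 0" using e by (simp add: d_def)
  obtain N0 where N0: "\<And>N. N \<ge> N0 \<Longrightarrow> \<bar>(1 / real N) * (\<Sum>n<N. u n) - a\<bar> < d"
    using LIMSEQ_D[OF lim d] by auto
  \<comment> \<open>\<open>B\<close> absorbs the finitely many initial sums taken before the
    averages are within \<open>d\<close> of the limit.\<close>
  define B where "B = (\<Sum>m<N0. \<bar>G m\<bar>)"
  have B0: "0 \<le> B" unfolding B_def by (rule sum_nonneg) simp
  have G: "\<bar>G m\<bar> \<le> d * real m + B" for m
  proof (cases "m < N0")
    case True
    then have "\<bar>G m\<bar> \<le> B" unfolding B_def by (intro member_le_sum) auto
    then show ?thesis using d by (simp add: add_increasing)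
  next
    case False
    show ?thesis
    proof (cases "m = 0")
      case True
      then show ?thesis using B0 by (simp add: G_def)
    next
      case m: False
      have "G m = real m * ((1 / real m) * (\<Sum>n<m. u n) - a)"
        using m by (simp add: G_def sum_subtractf algebra_simps)
      then have "\<bar>G m\<bar> = real m * \<bar>(1 / real m) * (\<Sum>n<m. u n) - a\<bar>" by (simp add: abs_mult)
      also have "\<dots> \<le> real m * d" using N0[of m] False by (intro mult_left_mono) auto
      finally show ?thesis using B0 by (simp add: mult.commute)
    qed
  qed
  obtain n0 :: nat where n0: "real n0 > 4 * B / e" using reals_Archimedean2 by blast
  have "\<bar>\<Sum>j=p..<q. u j - a\<bar> \<le> e * real n" if "n \<ge> n0" "p \<le> q" "q \<le> C * n" for n p q
  proof -
    have "{..<q} = {..<p} \<union> {p..<q}" using that(2) by auto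
    then have "G q = G p + (\<Sum>j=p..<q. u j - a)"
      unfolding G_def using sum.union_disjoint[of "{..<p}" "{p..<q}" "\<lambda>j. u j - a"] by force
    then have "\<bar>\<Sum>j=p..<q. u j - a\<bar> \<le> \<bar>G q\<bar> + \<bar>G p\<bar>" by linarith
    also have "\<dots> \<le> d * real q + d * real p + 2 * B" using G[of p] G[of q] by linarith
    also have "\<dots> \<le> 2 * (d * (real C * real n)) + 2 * B"
    proof -
      have "real q \<le> real C * real n" "real p \<le> real C * real n"
        using of_nat_mono[OF that(3), where 'a = real] of_nat_mono[OF that(2), where 'a = real] by simp_all
      then have "d * real q \<le> d * (real C * real n)" "d * real p \<le> d * (real C * real n)"
        using d by (auto intro: mult_left_mono)
      then show ?thesis by linarith
    qed
    also have "2 * (d * (real C * real n)) \<le> e / 2 * real n"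
    proof -
      have "2 * d * real C \<le> e / 2" using e by (simp add: d_def field_simps)
      from mult_right_mono[OF this, of "real n"] show ?thesis by (simp add: mult.assoc)
    qed
    also have "2 * B \<le> e / 2 * real n"
    proof -
      have "4 * B / e < real n" using n0 that(1) by linarith
      then show ?thesis using e by (simp add: field_simps)
    qed
    finally show ?thesis by simp
  qed
  then show ?thesis by blast
qed

lemma emeasure_lborel_vimage_plus:
  fixes a :: real
  assumes "A \<in> sets borel"
  shows "emeasure lborel ((+) a -` A) = emeasure lborel A"
proof -
  have "emeasure lborel A = emeasure (distr lborel borel ((+) a)) A"
    by (simp add: lborel_distr_plus)
  also have "\<dots> = emeasure lborel ((+) a -` A \<inter> space lborel)"
    using assms by (intro emeasure_distr) auto
  finally show ?thesis by simp
qed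

text \<open>The period \<open>p\<close> of the first prefix is inherited by all longer ones. From
  the new letter one steps back by \<open>q\<close>, back by \<open>p\<close> and forward by
  \<open>q\<close>, where \<open>q\<close> is a period of the longer prefix; both periods are short
  enough to stay inside it.\<close>

lemma nested_periods:
  fixes z :: "nat \<Rightarrow> 'a"
  assumes per: "\<And>m. m \<ge> m0 \<Longrightarrow> \<exists>p\<ge>1. 4 * p \<le> m \<and> (\<forall>j. j + p < m \<longrightarrow> z j = z (j + p))"
  shows "\<exists>p\<ge>1. \<forall>j. z j = z (j + p)"
proof -
  obtain p where p: "p \<ge> 1" "4 * p \<le> m0" "\<And>j. j + p < m0 \<Longrightarrow> z j = z (j + p)"
    using per[of m0] by blast
  have *: "m \<ge> m0 \<Longrightarrow> j + p < m \<Longrightarrow> z j = z (j + p)" for m j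
  proof (induction m arbitrary: j rule: dec_induct)
    case (step m)
    show ?case
    proof (cases "j + p < m")
      case False
      then have m: "m = j + p" using step.prems by simp
      obtain q where q: "q \<ge> 1" "4 * q \<le> Suc m" "\<And>j. j + q < Suc m \<Longrightarrow> z j = z (j + q)"
        using per[of "Suc m"] step.hyps by auto
      have pq: "p + q \<le> m" using p q step.hyps by linarith
      have "z m = z (m - q)" using q(3)[of "m - q"] pq by simp
      also have "\<dots> = z (m - q - p)" using step.IH[of "m - q - p"] pq q(1) by simp
      also have "\<dots> = z (m - q - p + q)" using q(3)[of "m - q - p"] pq by simp
      also have "m - q - p + q = j" using m pq by simp
      finally show ?thesis using m by simp
    qed (use step.IH in blast)
  qed (use p in auto)
  have "z j = z (j + p)" for j by (rule *[of "max m0 (Suc (j + p))"]) auto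
  then show ?thesis using p(1) by blast
qed

section \<open>Interval exchanges and their itineraries\<close>

locale minimal_exchange =
  fixes k :: nat and \<pi> :: "nat \<Rightarrow> nat" and l :: "nat \<Rightarrow> real"
  assumes minimal: "minimal_iet k \<pi> l"
begin

abbreviation X :: "real set" where "X \<equiv> {0..<l k}"
abbreviation T :: "real \<Rightarrow> real" where "T \<equiv> iet k \<pi> l"
abbreviation letter :: "real \<Rightarrow> nat" where "letter \<equiv> iet_index k l"

lemma iet_data: "iet_data k \<pi> l"
  using minimal by (simp add: minimal_iet_def)

lemma k_pos: "1 \<le> k" and perm: "\<pi> permutes {1..k}" and l_0: "l 0 = 0"
  using iet_data by (auto simp: iet_data_def)

lemma l_less: "a < b \<Longrightarrow> b \<le> k \<Longrightarrow> l a < l b"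
  using iet_data unfolding iet_data_def by (auto intro: strict_mono_onD)

lemma l_le: "a \<le> b \<Longrightarrow> b \<le> k \<Longrightarrow> l a \<le> l b"
  using l_less[of a b] by (cases "a = b") auto

lemma letter_eqI:
  assumes "i \<in> {1..k}" "l (i - 1) \<le> x" "x < l i"
  shows "letter x = i"
proof -
  have unique: "i' = i" if "i' \<in> {1..k}" "x \<in> {l (i' - 1)..<l i'}" for i'
  proof (rule ccontr)
    assume "i' \<noteq> i"
    then consider "i' \<le> i - 1" | "i \<le> i' - 1" by linarith
    then show False
    proof cases
      case 1
      then have "l i' \<le> l (i - 1)" using l_le assms(1) by auto
      then show False using that assms by auto
    next
      case 2
      then have "l i \<le> l (i' - 1)" using l_le that by auto
      then show False using that assms by auto
    qed
  qed
  show ?thesis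
    unfolding iet_index_def
  proof (rule the_equality)
    show "i \<in> {1..k} \<and> x \<in> {l (i - 1)..<l i}" using assms by simp
  qed (use unique in blast)
qed

lemma letter_bounds:
  assumes "x \<in> X"
  shows "letter x \<in> {1..k}" "l (letter x - 1) \<le> x" "x < l (letter x)"
proof -
  define i where "i = (LEAST i. x < l i)"
  have ex: "x < l k" using assms by simp
  have lt: "x < l i" unfolding i_def using ex by (rule LeastI)
  have ik: "i \<le> k" unfolding i_def using ex by (rule Least_le)
  have "i \<noteq> 0" using lt l_0 assms by (intro notI) simp
  have ge: "l (i - 1) \<le> x"
    using not_less_Least[of "i - 1" "\<lambda>i. x < l i", folded i_def] \<open>i \<noteq> 0\<close> by simp
  have "letter x = i" using letter_eqI ge lt ik \<open>i \<noteq> 0\<close> by auto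
  then show "letter x \<in> {1..k}" "l (letter x - 1) \<le> x" "x < l (letter x)"
    using ge lt ik \<open>i \<noteq> 0\<close> by auto
qed

lemma letter_mono:
  assumes "x \<in> X" "y \<in> X" "x \<le> y"
  shows "letter x \<le> letter y"
proof (rule ccontr)
  assume "\<not> ?thesis"
  then have "l (letter y) \<le> l (letter x - 1)"
    using letter_bounds(1)[OF assms(1)] by (intro l_le) auto
  then show False using letter_bounds[OF assms(1)] letter_bounds[OF assms(2)] assms(3) by linarith
qed

text \<open>Left endpoint of the image interval in position \<open>m\<close>. With an arbitrary
  position as argument, \<open>offset (Suc (\<pi> i))\<close> serves as the right endpoint of the
  image of the \<open>i\<close>-th interval.\<close>

definition offset :: "nat \<Rightarrow> real" where
  "offset m = (\<Sum>j | j \<in> {1..k} \<and> \<pi> j < m. l j - l (j - 1))"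

lemma T_eq: "T x = x - l (letter x - 1) + offset (\<pi> (letter x))"
  by (simp add: iet_def offset_def Let_def)

lemma T_translation: "letter x = letter y \<Longrightarrow> T y - T x = y - x"
  by (simp add: T_eq)

lemma len_pos: "j \<in> {1..k} \<Longrightarrow> 0 < l j - l (j - 1)"
  using l_less[of "j - 1" j] by auto

lemma offset_mono: "m \<le> m' \<Longrightarrow> offset m \<le> offset m'"
  unfolding offset_def using len_pos by (intro sum_mono2) (auto intro: less_imp_le)

lemma offset_Suc:
  assumes "i \<in> {1..k}"
  shows "offset (Suc (\<pi> i)) = offset (\<pi> i) + (l i - l (i - 1))"
proof -
  have "inj \<pi>" using perm by (rule permutes_inj)
  then have "{j. j \<in> {1..k} \<and> \<pi> j < Suc (\<pi> i)} = insert i {j. j \<in> {1..k} \<and> \<pi> j < \<pi> i}"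
    using assms by (auto simp: less_Suc_eq dest: injD)
  then show ?thesis unfolding offset_def by simp
qed

lemma offset_1: "offset (Suc 0) = 0"
proof -
  have "\<pi> j \<in> {1..k}" if "j \<in> {1..k}" for j using permutes_in_image[OF perm] that by blast
  then have "{j. j \<in> {1..k} \<and> \<pi> j < Suc 0} = {}" by fastforce
  then show ?thesis by (simp only: offset_def sum.empty)
qed

lemma offset_last: "offset (Suc k) = l k"
proof -
  have "\<pi> j \<in> {1..k}" if "j \<in> {1..k}" for j using permutes_in_image[OF perm] that by blast
  then have "{j. j \<in> {1..k} \<and> \<pi> j < Suc k} = {1..k}" by fastforce
  moreover have "(\<Sum>j\<in>{1..m}. l j - l (j - 1)) = l m - l 0" for m
    by (induction m) auto
  ultimately show ?thesis by (simp only: offset_def) (simp add: l_0)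
qed

lemma T_bounds:
  assumes "x \<in> X"
  shows "offset (\<pi> (letter x)) \<le> T x" "T x < offset (Suc (\<pi> (letter x)))"
  using letter_bounds[OF assms] by (auto simp: T_eq offset_Suc)

lemma T_in: "x \<in> X \<Longrightarrow> T x \<in> X"
proof -
  assume x: "x \<in> X"
  have "\<pi> (letter x) \<in> {1..k}" using permutes_in_image[OF perm] letter_bounds(1)[OF x] by blast
  then have "offset (Suc 0) \<le> offset (\<pi> (letter x))" "offset (Suc (\<pi> (letter x))) \<le> offset (Suc k)"
    by (auto intro!: offset_mono)
  then show ?thesis using T_bounds[OF x] offset_1 offset_last by auto
qed

lemma inj_T: "inj_on T X"
proof -
  have *: False if "x \<in> X" "y \<in> X" "T x = T y" "\<pi> (letter x) < \<pi> (letter y)" for x y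
    using T_bounds[OF that(1)] T_bounds[OF that(2)] that(3) that(4)
      offset_mono[of "Suc (\<pi> (letter x))" "\<pi> (letter y)"] by auto
  show ?thesis
  proof (rule inj_onI)
    fix x y assume xy: "x \<in> X" "y \<in> X" "T x = T y"
    then have "\<pi> (letter x) = \<pi> (letter y)"
      using *[of x y] *[of y x] by (metis linorder_less_linear)
    then have "letter x = letter y" using permutes_inj[OF perm] by (auto dest: injD)
    then show "x = y" using T_translation[of x y] xy(3) by simp
  qed
qed

lemma surj_T: "T ` X = X"
proof
  show "T ` X \<subseteq> X" using T_in by auto
  show "X \<subseteq> T ` X"
  proof
    fix y assume y: "y \<in> X"
    \<comment> \<open>Positions start at 1, so \<open>P m\<close> speaks of position
      \<open>Suc m\<close>; this makes \<open>P 0\<close> true and the greatest \<open>m\<close>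
      exist.\<close>
    define P where "P m \<longleftrightarrow> m \<le> k \<and> offset (Suc m) \<le> y" for m
    define m where "m = (GREATEST m. P m)"
    have P0: "P 0" using y by (simp add: P_def offset_1)
    have Pm: "P m" unfolding m_def using P0 by (rule GreatestI_nat[where b = k]) (simp add: P_def)
    have "m \<noteq> k" using Pm y by (auto simp: P_def offset_last)
    then have mk: "m < k" using Pm by (simp add: P_def)
    have "\<not> P (Suc m)"
      using Greatest_le_nat[of P "Suc m" k] unfolding m_def[symmetric] P_def by auto
    then have up: "y < offset (Suc (Suc m))" using mk by (simp add: P_def)
    obtain i where i: "i \<in> {1..k}" "\<pi> i = Suc m"
      using permutes_image[OF perm] mk
      by (metis (no_types, lifting) Suc_leI atLeastAtMost_iff imageE le_add1 plus_1_eq_Suc)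
    define x where "x = y - offset (Suc m) + l (i - 1)"
    have "offset (Suc m) \<le> y" using Pm by (simp add: P_def)
    then have b: "l (i - 1) \<le> x" "x < l i"
      using up offset_Suc[OF i(1)] by (auto simp: x_def i(2))
    have li: "letter x = i" by (rule letter_eqI[OF i(1) b])
    have "0 \<le> l (i - 1)" using l_le[of 0 "i - 1"] i(1) by (auto simp: l_0)
    moreover have "l i \<le> l k" using l_le i(1) by auto
    ultimately have "x \<in> X" using b by auto
    moreover have "T x = y" by (simp only: T_eq li i(2)) (simp add: x_def)
    ultimately show "y \<in> T ` X" by blast
  qed
qed

lemma bij_T: "bij_betw T X X"
  using inj_T surj_T by (simp add: bij_betw_def)

lemma bij_Tn: "bij_betw (T ^^ n) X X"
  by (rule bij_betw_funpow[OF bij_T])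

lemma Tn_in: "x \<in> X \<Longrightarrow> (T ^^ n) x \<in> X"
  using bij_Tn[of n] by (auto simp: bij_betw_def)

lemma Tn_inj: "x \<in> X \<Longrightarrow> y \<in> X \<Longrightarrow> (T ^^ n) x = (T ^^ n) y \<Longrightarrow> x = y"
  using bij_Tn[of n] by (auto simp: bij_betw_def dest: inj_onD)

lemma Tn_add: "(T ^^ m) ((T ^^ n) x) = (T ^^ (m + n)) x"
  by (simp add: funpow_add)

definition past :: "nat \<Rightarrow> real \<Rightarrow> real" where
  "past n = inv_into X (T ^^ n)"

lemma past_in: "x \<in> X \<Longrightarrow> past n x \<in> X"
  unfolding past_def using bij_Tn[of n] by (metis bij_betw_imp_surj_on inv_into_into)

lemma Tn_past: "x \<in> X \<Longrightarrow> (T ^^ n) (past n x) = x"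
  unfolding past_def using bij_Tn[of n] by (metis bij_betw_imp_surj_on f_inv_into_f)

lemma past_Tn: "x \<in> X \<Longrightarrow> past n ((T ^^ n) x) = x"
  using Tn_past[OF Tn_in, of x n n] Tn_inj[OF past_in[OF Tn_in]] by auto

lemma Tn_past_le:
  assumes "x \<in> X" "m \<le> n"
  shows "(T ^^ m) (past n x) = past (n - m) x"
proof -
  have "(T ^^ (n - m)) ((T ^^ m) (past n x)) = x"
    using assms Tn_past[of x n] by (simp add: Tn_add)
  then show ?thesis
    using past_Tn[OF Tn_in[OF past_in[OF assms(1)]], of "n - m" m n] by simp
qed

section \<open>Finite itineraries, cylinders and the number of words\<close>

definition word :: "nat \<Rightarrow> real \<Rightarrow> nat list" where
  "word n x = map (\<lambda>j. letter ((T ^^ j) x)) [0..<n]"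

lemma length_word [simp]: "length (word n x) = n"
  by (simp add: word_def)

lemma word_nth [simp]: "j < n \<Longrightarrow> word n x ! j = letter ((T ^^ j) x)"
  by (simp add: word_def)

lemma word_eq_iff: "word n x = word n y \<longleftrightarrow> (\<forall>j<n. letter ((T ^^ j) x) = letter ((T ^^ j) y))"
  by (auto simp: list_eq_iff_nth_eq)

lemma word_eq_le: "word n x = word n y \<Longrightarrow> m \<le> n \<Longrightarrow> word m x = word m y"
  by (simp add: word_eq_iff)

lemma word_eq_shift:
  "word n x = word n y \<Longrightarrow> m + s \<le> n \<Longrightarrow> word m ((T ^^ s) x) = word m ((T ^^ s) y)"
  by (auto simp: word_eq_iff Tn_add)

lemma word_eq_Suc:
  "word (Suc n) x = word (Suc n) y \<longleftrightarrow> word n x = word n y \<and> letter ((T ^^ n) x) = letter ((T ^^ n) y)"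
  by (auto simp: word_eq_iff less_Suc_eq)

text \<open>Each step translates by an amount that depends only on the current letter.\<close>

lemma word_translation:
  assumes "word n x = word n y" "j \<le> n"
  shows "(T ^^ j) y - (T ^^ j) x = y - x"
  using assms(2)
proof (induction j)
  case (Suc j)
  then have "letter ((T ^^ j) x) = letter ((T ^^ j) y)" using assms(1) by (auto simp: word_eq_iff)
  from T_translation[OF this] Suc show ?case by simp
qed simp

text \<open>Cylinders are intervals: as long as the words agree, iterates preserve the order, and
  the letter is monotone in the point.\<close>

lemma word_between:
  assumes "x \<in> X" "y \<in> X" "word n x = word n y" "x \<le> z" "z \<le> y"
  shows "word n x = word n z"
proof -
  have z: "z \<in> X" using assms by auto
  have "m \<le> n \<Longrightarrow> word m x = word m z" for m
  proof (induction m)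
    case (Suc m)
    then have IH: "word m x = word m z" and m: "m < n" by auto
    from word_translation[OF IH, of m] word_translation[OF assms(3), of m] m assms(4,5)
    have "(T ^^ m) x \<le> (T ^^ m) z" "(T ^^ m) z \<le> (T ^^ m) y" by auto
    then have "letter ((T ^^ m) x) \<le> letter ((T ^^ m) z)" "letter ((T ^^ m) z) \<le> letter ((T ^^ m) y)"
      using assms z by (auto intro!: letter_mono Tn_in)
    moreover have "letter ((T ^^ m) x) = letter ((T ^^ m) y)"
      using assms(3) m by (auto simp: word_eq_iff)
    ultimately show ?case using IH by (simp add: word_eq_Suc)
  qed (simp add: word_def)
  then show ?thesis by simp
qed

lemma letter_neq_imp_cut:
  assumes "x \<in> X" "y \<in> X" "x \<le> y" "letter x \<noteq> letter y"
  shows "\<exists>s\<in>{1..k-1}. x < l s \<and> l s \<le> y"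
proof -
  have lt: "letter x < letter y" using letter_mono[OF assms(1-3)] assms(4) by simp
  have "l (letter x) \<le> l (letter y - 1)"
    using lt letter_bounds(1)[OF assms(2)] by (intro l_le) auto
  then have "x < l (letter x)" "l (letter x) \<le> y"
    using letter_bounds[OF assms(1)] letter_bounds[OF assms(2)] by auto
  moreover have "letter x \<in> {1..k-1}"
    using lt letter_bounds(1)[OF assms(1)] letter_bounds(1)[OF assms(2)] by auto
  ultimately show ?thesis by blast
qed

lemma cut_in: "s \<in> {1..k-1} \<Longrightarrow> l s \<in> X"
  using l_le[of 0 s] l_less[of s k] k_pos by (auto simp: l_0)

lemma zero_in: "0 \<in> X"
  using l_less[of 0 k] k_pos by (auto simp: l_0)

text \<open>At the first time \<open>j\<close> of disagreement an interior endpoint separates the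
  two images. Up to then the points in between all move by the same translation, so this endpoint
  pulls back to a point between \<open>x\<close> and \<open>y\<close>.\<close>

lemma word_neq_imp_cut:
  assumes "x \<in> X" "y \<in> X" "x \<le> y" "word n x \<noteq> word n y"
  shows "\<exists>j<n. \<exists>s\<in>{1..k-1}. x < past j (l s) \<and> past j (l s) \<le> y \<and> word j (past j (l s)) = word j x
    \<and> word j x = word j y"
  using assms(4)
proof (induction n)
  case 0
  then show ?case by (simp add: word_def)
next
  case (Suc n)
  show ?case
  proof (cases "word n x = word n y")
    case False
    from Suc.IH[OF this] show ?thesis using less_SucI by blast
  next
    case True
    then have neq: "letter ((T ^^ n) x) \<noteq> letter ((T ^^ n) y)" using Suc.prems by (simp add: word_eq_Suc)
    have tr: "(T ^^ n) y - (T ^^ n) x = y - x" by (rule word_translation[OF True]) simp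
    obtain s where s: "s \<in> {1..k-1}" "(T ^^ n) x < l s" "l s \<le> (T ^^ n) y"
      using letter_neq_imp_cut[OF Tn_in Tn_in _ neq] assms tr by auto
    define z where "z = x + (l s - (T ^^ n) x)"
    have z: "x < z" "z \<le> y" using s tr by (auto simp: z_def)
    have zX: "z \<in> X" using z assms by auto
    have w: "word n x = word n z" using word_between[OF assms(1,2) True] z by simp
    have "(T ^^ n) z = l s" using word_translation[OF w, of n] by (simp add: z_def)
    then have "z = past n (l s)" using past_Tn[OF zX, of n] by simp
    then show ?thesis
      using z s(1) w True by (intro exI[of _ n] conjI bexI[of _ s]) auto
  qed
qed

text \<open>Words change only at points \<open>past j (l s)\<close> with \<open>j < n\<close>. Hence
  each point has the word of the nearest point of \<open>E\<close> on its left, where 0 accounts for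
  the summand 1.\<close>

lemma words_card:
  "finite (word n ` X)" "card (word n ` X) \<le> (k - 1) * n + 1"
proof -
  define E where "E = insert 0 ((\<lambda>(j, s). past j (l s)) ` ({..<n} \<times> {1..k-1}))"
  have fE: "finite E" by (simp add: E_def)
  have "card ((\<lambda>(j, s). past j (l s)) ` ({..<n} \<times> {1..k-1})) \<le> (k - 1) * n"
    using card_image_le[of "{..<n} \<times> {1..k-1}" "\<lambda>(j, s). past j (l s)"]
    by (simp add: card_cartesian_product mult.commute)
  then have cE: "card E \<le> (k - 1) * n + 1"
    unfolding E_def by (auto simp: card_insert_if)
  have EX: "E \<subseteq> X" using cut_in past_in zero_in by (auto simp: E_def)
  have "word n x \<in> word n ` E" if x: "x \<in> X" for x
  proof -
    define z where "z = Max {z \<in> E. z \<le> x}"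
    have ne: "finite {z \<in> E. z \<le> x}" "{z \<in> E. z \<le> x} \<noteq> {}"
      using fE x by (auto simp: E_def)
    have z: "z \<in> E" "z \<le> x" using Max_in[OF ne] by (auto simp: z_def)
    have mx: "z' \<le> z" if "z' \<in> E" "z' \<le> x" for z'
      using Max_ge[OF ne(1)] that by (auto simp: z_def)
    have "word n z = word n x"
    proof (rule ccontr)
      assume "word n z \<noteq> word n x"
      from word_neq_imp_cut[OF subsetD[OF EX z(1)] x z(2) this] obtain j s where
        "j < n" "s \<in> {1..k-1}" "z < past j (l s)" "past j (l s) \<le> x" by blast
      moreover have "past j (l s) \<in> E"
        unfolding E_def using calculation(1,2)
        by (intro insertI2 image_eqI[of _ _ "(j, s)"]) auto
      ultimately show False using mx[of "past j (l s)"] by linarith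
    qed
    then show ?thesis using z(1) by (metis imageI)
  qed
  then have sub: "word n ` X \<subseteq> word n ` E" by auto
  then show "finite (word n ` X)" using fE by (meson finite_imageI finite_subset)
  have "card (word n ` X) \<le> card (word n ` E)" using sub fE by (intro card_mono) auto
  also have "\<dots> \<le> card E" by (rule card_image_le[OF fE])
  finally show "card (word n ` X) \<le> (k - 1) * n + 1" using cE by simp
qed

section \<open>Right special words\<close>

text \<open>The Rauzy graph has the words of length \<open>n\<close> as vertices and edges from
  \<open>word n x\<close> to \<open>word n (T x)\<close>. For \<open>n \<ge> 1\<close> the right
  special words are its branching vertices.\<close>

definition right_special :: "nat \<Rightarrow> nat list set" where
  "right_special n = {w. \<exists>x\<in>X. \<exists>y\<in>X. word n x = w \<and> word n y = w \<and> letter ((T ^^ n) x) \<noteq> letter ((T ^^ n) y)}"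

text \<open>Two points with the same word but different next letters are separated by some
  \<open>past j (l s)\<close>, and the time \<open>j\<close> of the cut can only be
  \<open>n\<close>.\<close>

lemma right_special_subset: "right_special n \<subseteq> (\<lambda>s. word n (past n (l s))) ` {1..k-1}"
proof
  fix w assume "w \<in> right_special n"
  then obtain x y where xy: "x \<in> X" "y \<in> X" "word n x = w" "word n y = w"
    "letter ((T ^^ n) x) \<noteq> letter ((T ^^ n) y)" by (auto simp: right_special_def)
  have *: "w \<in> (\<lambda>s. word n (past n (l s))) ` {1..k-1}"
    if "x \<in> X" "y \<in> X" "word n x = w" "word n y = w" "x \<le> y"
      "letter ((T ^^ n) x) \<noteq> letter ((T ^^ n) y)" for x y
  proof -
    have "word (Suc n) x \<noteq> word (Suc n) y" using that by (simp add: word_eq_Suc)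
    from word_neq_imp_cut[OF that(1,2,5) this] obtain j s where
      js: "j < Suc n" "s \<in> {1..k-1}" "word j (past j (l s)) = word j x" "x < past j (l s)"
        "past j (l s) \<le> y" by blast
    have w: "word n x = word n (past j (l s))"
      by (rule word_between[OF that(1,2)]) (use that js in auto)
    \<comment> \<open>For \<open>j < n\<close> the endpoint \<open>l s\<close> would open a new
      letter strictly to the right of \<open>(T ^^ j) x\<close>, although both carry the same
      letter.\<close>
    have "j = n"
    proof (rule ccontr)
      assume "j \<noteq> n"
      then have "j < n" using js by simp
      then have "letter ((T ^^ j) x) = letter ((T ^^ j) (past j (l s)))"
        using w by (simp add: word_eq_iff)
      moreover have "(T ^^ j) (past j (l s)) = l s" using Tn_past cut_in js(2) by blast
      moreover have "(T ^^ j) x < l s"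
        using word_translation[OF js(3), of j] js(4) calculation(2) by simp
      moreover have "letter (l s) = Suc s"
        using js(2) l_less[of s "Suc s"] by (intro letter_eqI) auto
      moreover have "l s \<le> (T ^^ j) x"
        using letter_bounds(2)[OF Tn_in[OF that(1)], of j] calculation by simp
      ultimately show False by simp
    qed
    then show ?thesis using w that(3) js(2) by (intro image_eqI[of _ _ s]) simp_all
  qed
  show "w \<in> (\<lambda>s. word n (past n (l s))) ` {1..k-1}"
  proof (cases "x \<le> y")
    case True
    show ?thesis by (rule *[OF xy(1-4) True xy(5)])
  next
    case False
    then show ?thesis by (intro *[OF xy(2,1,4,3) _ xy(5)[symmetric]]) simp
  qed
qed

lemma right_special_words: "right_special n \<subseteq> word n ` X"
  by (auto simp: right_special_def)

lemma not_right_special_determines: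
  assumes "x \<in> X" "y \<in> X" "word n x = word n y" "word n x \<notin> right_special n"
  shows "word (Suc n) x = word (Suc n) y"
  unfolding word_eq_Suc using assms unfolding right_special_def mem_Collect_eq by metis

text \<open>The exchanged intervals are closed on the left and open on the right. The small interval
  found here is what recurrence and density are applied to later.\<close>

lemma word_right_open:
  assumes "x \<in> X"
  shows "\<exists>e>0. {x..<x+e} \<subseteq> X \<and> (\<forall>z\<in>{x..<x+e}. word n z = word n x)"
proof (induction n)
  case 0
  show ?case using assms by (intro exI[of _ "l k - x"]) (auto simp: word_def)
next
  case (Suc n)
  then obtain e where e: "e > 0" "{x..<x+e} \<subseteq> X" "\<And>z. z \<in> {x..<x+e} \<Longrightarrow> word n z = word n x"
    by blast
  define i where "i = letter ((T ^^ n) x)"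
  have i: "i \<in> {1..k}" "l (i - 1) \<le> (T ^^ n) x" "(T ^^ n) x < l i"
    using letter_bounds[OF Tn_in[OF assms]] by (auto simp: i_def)
  define e' where "e' = min e (l i - (T ^^ n) x)"
  have "word (Suc n) z = word (Suc n) x" if z: "z \<in> {x..<x+e'}" for z
  proof -
    have w: "word n z = word n x" by (rule e(3)) (use z in \<open>auto simp: e'_def\<close>)
    from word_translation[OF w, of n] have "(T ^^ n) z = (T ^^ n) x + (z - x)" by simp
    then have "l (i - 1) \<le> (T ^^ n) z" "(T ^^ n) z < l i" using i z by (auto simp: e'_def)
    from letter_eqI[OF i(1) this] w show ?thesis by (simp add: word_eq_Suc i_def)
  qed
  moreover have "0 < e'" "{x..<x+e'} \<subseteq> X"
    using e(1,2) i by (auto simp: e'_def subset_iff)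
  ultimately show ?case by blast
qed

section \<open>Recurrence and irreducibility\<close>

text \<open>\<open>T\<close> preserves Lebesgue measure because it translates finitely many pieces
  onto the disjoint intervals \<open>Q i\<close>, which cover \<open>X\<close>.\<close>

lemma vimage_T:
  assumes B: "B \<in> sets borel" "B \<subseteq> X"
  shows "{x \<in> X. T x \<in> B} \<in> sets borel"
    and "emeasure lborel {x \<in> X. T x \<in> B} = emeasure lborel B"
proof -
  define Q where "Q i = {offset (\<pi> i)..<offset (Suc (\<pi> i))}" for i
  define \<tau> where "\<tau> i = offset (\<pi> i) - l (i - 1)" for i
  \<comment> \<open>The part of the preimage in the \<open>i\<close>-th interval, written as a
    translate of the part of \<open>B\<close> in \<open>Q i\<close>.\<close>
  define R where "R i = (+) (\<tau> i) -` (B \<inter> Q i)" for i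
  have Q_len: "offset (Suc (\<pi> i)) = offset (\<pi> i) + (l i - l (i - 1))" if "i \<in> {1..k}" for i
    using offset_Suc that by simp
  have R_iff: "x \<in> R i \<longleftrightarrow> letter x = i \<and> T x \<in> B" if "i \<in> {1..k}" "x \<in> X" for i x
  proof
    assume "x \<in> R i"
    then have x: "\<tau> i + x \<in> B" "l (i - 1) \<le> x" "x < l i"
      using Q_len[OF that(1)] by (auto simp: R_def Q_def \<tau>_def)
    then have "letter x = i" using letter_eqI that(1) by blast
    then show "letter x = i \<and> T x \<in> B" using x by (simp add: T_eq \<tau>_def algebra_simps)
  next
    assume a: "letter x = i \<and> T x \<in> B"
    then have "T x \<in> Q i" using T_bounds[OF that(2)] by (auto simp: Q_def)
    moreover have "T x = \<tau> i + x" using a by (simp add: T_eq \<tau>_def)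
    ultimately show "x \<in> R i" using a by (simp add: R_def)
  qed
  have R_X: "R i \<subseteq> X" if i: "i \<in> {1..k}" for i
  proof
    fix x assume "x \<in> R i"
    then have x: "l (i - 1) \<le> x" "x < l i"
      using Q_len[OF i] by (auto simp: R_def Q_def \<tau>_def)
    moreover have "0 \<le> l (i - 1)" using l_le[of 0 "i - 1"] i by (auto simp: l_0)
    moreover have "l i \<le> l k" using l_le[of i k] i by simp
    ultimately show "x \<in> X" by simp
  qed
  have eq: "{x \<in> X. T x \<in> B} = (\<Union>i\<in>{1..k}. R i)"
    using R_iff R_X letter_bounds(1) by blast
  have Rm: "R i \<in> sets borel" for i
  proof -
    have "(+) (\<tau> i) -` (B \<inter> Q i) \<inter> space borel \<in> sets borel"
      by (rule measurable_sets[of _ borel borel]) (use B in \<open>auto simp: Q_def\<close>)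
    then show ?thesis by (simp add: R_def)
  qed
  show "{x \<in> X. T x \<in> B} \<in> sets borel" unfolding eq using Rm by auto
  have disjR: "disjoint_family_on R {1..k}"
    unfolding disjoint_family_on_def using R_iff R_X by blast
  have disjQ: "Q i \<inter> Q j = {}" if "i \<in> {1..k}" "j \<in> {1..k}" "i \<noteq> j" for i j
  proof -
    have "\<pi> i \<noteq> \<pi> j" using that(3) permutes_inj[OF perm] by (auto dest: injD)
    then have "Suc (\<pi> i) \<le> \<pi> j \<or> Suc (\<pi> j) \<le> \<pi> i" by linarith
    then show ?thesis
      using offset_mono[of "Suc (\<pi> i)" "\<pi> j"] offset_mono[of "Suc (\<pi> j)" "\<pi> i"]
      by (auto simp: Q_def)
  qed
  have cover: "B = (\<Union>i\<in>{1..k}. B \<inter> Q i)"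
  proof -
    have "\<exists>i\<in>{1..k}. y \<in> Q i" if "y \<in> B" for y
    proof -
      have "y \<in> T ` X" unfolding surj_T using that B(2) by (rule subsetD[rotated])
      then obtain x where x: "x \<in> X" "y = T x" by (rule imageE)
      then have "y \<in> Q (letter x)" using T_bounds[OF x(1)] by (simp add: Q_def)
      then show ?thesis using letter_bounds(1)[OF x(1)] by blast
    qed
    then show ?thesis by blast
  qed
  have "emeasure lborel {x \<in> X. T x \<in> B} = (\<Sum>i\<in>{1..k}. emeasure lborel (R i))"
    unfolding eq using Rm disjR by (intro sum_emeasure[symmetric]) auto
  also have "\<dots> = (\<Sum>i\<in>{1..k}. emeasure lborel (B \<inter> Q i))"
    unfolding R_def using B by (intro sum.cong refl emeasure_lborel_vimage_plus) (auto simp: Q_def)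
  also have "\<dots> = emeasure lborel (\<Union>i\<in>{1..k}. B \<inter> Q i)"
  proof (rule sum_emeasure)
    show "(\<lambda>i. B \<inter> Q i) ` {1..k} \<subseteq> sets lborel" using B by (auto simp: Q_def)
    show "disjoint_family_on (\<lambda>i. B \<inter> Q i) {1..k}"
      unfolding disjoint_family_on_def using disjQ by blast
  qed simp
  finally show "emeasure lborel {x \<in> X. T x \<in> B} = emeasure lborel B"
    using cover by simp
qed

lemma vimage_Tn:
  assumes B: "B \<in> sets borel" "B \<subseteq> X"
  shows "{x \<in> X. (T ^^ n) x \<in> B} \<in> sets borel \<and>
    emeasure lborel {x \<in> X. (T ^^ n) x \<in> B} = emeasure lborel B"
proof (induction n)
  case 0
  have "{x \<in> X. x \<in> B} = B" using B by auto
  then show ?case using B by simp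
next
  case (Suc n)
  define C where "C = {x \<in> X. (T ^^ n) x \<in> B}"
  have "{x \<in> X. (T ^^ Suc n) x \<in> B} = {x \<in> X. T x \<in> C}"
    using T_in by (auto simp: C_def funpow_swap1)
  moreover have "C \<in> sets borel" "C \<subseteq> X" "emeasure lborel C = emeasure lborel B"
    using Suc by (auto simp: C_def)
  ultimately show ?case using vimage_T[of C] by simp
qed

text \<open>Poincare recurrence: the preimages of a set without returns are pairwise disjoint and of
  equal positive measure, but \<open>X\<close> has finite length.\<close>

lemma recurrence:
  assumes J: "J \<in> sets borel" "J \<subseteq> X" "0 < emeasure lborel J"
  shows "\<exists>x\<in>J. \<exists>n\<ge>1. (T ^^ n) x \<in> J"
proof (rule ccontr)
  assume no: "\<not> ?thesis"
  define A where "A n = {x \<in> X. (T ^^ n) x \<in> J}" for n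
  have meas: "A n \<in> sets lborel" "emeasure lborel (A n) = emeasure lborel J" for n
    using vimage_Tn[OF J(1,2), of n] by (auto simp: A_def)
  have "A m \<inter> A n = {}" if "m < n" for m n
  proof (rule ccontr)
    assume "A m \<inter> A n \<noteq> {}"
    then obtain x where "(T ^^ m) x \<in> J" "(T ^^ n) x \<in> J" by (auto simp: A_def)
    then show False
      using no that Tn_add[of "n - m" m x]
      by (metis le_add_diff_inverse2 less_imp_le_nat less_one linorder_not_le zero_less_diff)
  qed
  then have disj: "disjoint_family A"
    unfolding disjoint_family_on_def by (metis Int_commute linorder_neqE_nat)
  have "emeasure lborel J \<le> emeasure lborel X" by (rule emeasure_mono) (use J in auto)
  then have fin: "emeasure lborel J < \<infinity>" using zero_in by (auto simp: top.not_eq_extremum intro: le_less_trans)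
  then obtain c where c: "emeasure lborel J = ennreal c" "0 < c"
    using J(3) by (cases "emeasure lborel J") auto
  obtain N :: nat where N: "real N * c > l k" using reals_Archimedean3[OF c(2)] by blast
  have "(\<Sum>n\<in>{..<N}. emeasure lborel (A n)) = emeasure lborel (\<Union>n\<in>{..<N}. A n)"
    using meas disj by (intro sum_emeasure) (auto simp: disjoint_family_on_def)
  also have "\<dots> \<le> emeasure lborel X" by (rule emeasure_mono) (auto simp: A_def)
  also have "\<dots> = ennreal (l k)" using zero_in by simp
  finally have "ennreal (real N * c) \<le> ennreal (l k)"
    using c by (simp add: meas ennreal_of_nat_eq_real_of_nat flip: ennreal_mult)
  then show False using N zero_in by (simp add: ennreal_le_iff)
qed

lemma full_orbit_subset:
  assumes "O' \<subseteq> X" "T ` O' = O'" "x \<in> O'"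
  shows "full_orbit X T x \<subseteq> O'"
proof -
  have "(T ^^ n) x \<in> O'" for n using assms by (induction n) auto
  moreover have "(inv_into X T ^^ n) x \<in> O'" for n
  proof (induction n)
    case (Suc n)
    then obtain z where z: "z \<in> O'" "(inv_into X T ^^ n) x = T z" using assms(2) by (metis imageE)
    then have "inv_into X T (T z) = z" using assms(1) by (intro inv_into_f_f[OF inj_T]) auto
    then show ?case using z by simp
  qed (use assms in simp)
  ultimately show ?thesis by (auto simp: full_orbit_def)
qed

lemma full_orbit_dense: "x \<in> X \<Longrightarrow> X \<subseteq> closure (full_orbit X T x)"
  using minimal by (auto simp: minimal_iet_def)

text \<open>A set of words closed under the edges of the Rauzy graph could only be left by a wandering
  interval on its boundary, so by recurrence it is also closed under the reversed edges.\<close>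

lemma closed_words_full:
  assumes ne: "x \<in> X" "word n x \<in> S"
    and closed: "\<And>y. y \<in> X \<Longrightarrow> word n y \<in> S \<Longrightarrow> word n (T y) \<in> S"
    and z: "z \<in> X"
  shows "word n z \<in> S"
proof -
  define A where "A = {y \<in> X. word n y \<in> S}"
  have TA: "T y \<in> A" if "y \<in> A" for y using that closed T_in by (auto simp: A_def)
  have TnA: "(T ^^ m) y \<in> A" if "y \<in> A" for y m using that TA by (induction m) auto
  \<comment> \<open>If \<open>y\<close> were outside \<open>A\<close>, so would be a whole interval
    to its right with the same word. Recurrence brings a point \<open>u\<close> back to this
    interval, although \<open>T u\<close> is in the forward invariant set \<open>A\<close>.\<close>
  have backward: "y \<in> A" if y: "y \<in> X" "T y \<in> A" for y
  proof (rule ccontr)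
    assume nA: "y \<notin> A"
    obtain e where e: "e > 0" "{y..<y+e} \<subseteq> X" "\<And>z. z \<in> {y..<y+e} \<Longrightarrow> word (Suc n) z = word (Suc n) y"
      using word_right_open[OF y(1), of "Suc n"] by blast
    obtain u m where u: "u \<in> {y..<y+e}" "m \<ge> 1" "(T ^^ m) u \<in> {y..<y+e}"
      using recurrence[of "{y..<y+e}"] e by auto
    have notA: "v \<notin> A" if "v \<in> {y..<y+e}" for v
      using nA y word_eq_le[OF e(3)[OF that], of n] by (auto simp: A_def)
    have "word n (T u) = word n (T y)" using word_eq_shift[OF e(3)[OF u(1)], of n 1] by simp
    then have "T u \<in> A" using y u e T_in by (auto simp: A_def)
    then have "(T ^^ (m - 1)) (T u) \<in> A" by (rule TnA)
    then have "(T ^^ m) u \<in> A" using u(2) Tn_add[of "m - 1" 1 u] by simp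
    then show False using notA u(3) by blast
  qed
  have "T ` A = A"
  proof
    show "A \<subseteq> T ` A"
    proof
      fix y assume y: "y \<in> A"
      then have "y \<in> T ` X" unfolding surj_T by (simp add: A_def)
      then obtain v where "v \<in> X" "y = T v" by (rule imageE)
      then show "y \<in> T ` A" using backward y by blast
    qed
  qed (use TA in auto)
  then have orb: "full_orbit X T x \<subseteq> A"
    using ne by (intro full_orbit_subset) (auto simp: A_def)
  obtain e where e: "e > 0" "{z..<z+e} \<subseteq> X" "\<And>v. v \<in> {z..<z+e} \<Longrightarrow> word n v = word n z"
    using word_right_open[OF z, of n] by blast
  \<comment> \<open>Density only puts points in the closure of the orbit; passing to the open
    interior of the interval yields an actual orbit point with the word of \<open>z\<close>.\<close>
  have "z + e / 2 \<in> {z<..<z+e} \<inter> closure (full_orbit X T x)"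
    using e(1,2) full_orbit_dense[OF ne(1)] by (auto simp: subset_iff)
  then obtain v where v: "v \<in> {z<..<z+e}" "v \<in> full_orbit X T x"
    using open_Int_closure_eq_empty[OF open_greaterThanLessThan, of z "z+e" "full_orbit X T x"]
    by blast
  then have "v \<in> A" "word n v = word n z" using orb e(3)[of v] by auto
  then show ?thesis by (simp add: A_def)
qed

section \<open>Aperiodicity\<close>

text \<open>A periodic orbit is finite, hence closed, and cannot be dense in the infinite set
  \<open>X\<close>.\<close>

lemma aperiodic:
  assumes x: "x \<in> X" and p: "p \<ge> 1"
  shows "(T ^^ p) x \<noteq> x"
proof
  assume per: "(T ^^ p) x = x"
  define O' where "O' = (\<lambda>j. (T ^^ j) x) ` {..<p}"
  have "T ` O' = O'"
  proof
    show "T ` O' \<subseteq> O'"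
    proof
      fix y assume "y \<in> T ` O'"
      then obtain j where j: "j < p" "y = (T ^^ Suc j) x" by (auto simp: O'_def)
      show "y \<in> O'"
      proof (cases "Suc j < p")
        case True
        then show ?thesis unfolding O'_def j(2) by (intro image_eqI[of _ _ "Suc j"]) auto
      next
        case False
        then have "Suc j = p" using j by simp
        then have "y = (T ^^ 0) x" using j(2) per by simp
        then show ?thesis unfolding O'_def using p by (intro image_eqI[of _ _ 0]) auto
      qed
    qed
    show "O' \<subseteq> T ` O'"
    proof
      fix y assume "y \<in> O'"
      then obtain j where j: "j < p" "y = (T ^^ j) x" by (auto simp: O'_def)
      show "y \<in> T ` O'"
      proof (cases j)
        case 0
        then have "y = T ((T ^^ (p - 1)) x)" using per p j(2) Tn_add[of 1 "p - 1" x] by simp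
        then show ?thesis unfolding O'_def using p by auto
      next
        case (Suc i)
        then have "y = T ((T ^^ i) x)" using j by simp
        then show ?thesis unfolding O'_def using Suc j by auto
      qed
    qed
  qed
  moreover have "O' \<subseteq> X" using Tn_in x by (auto simp: O'_def)
  moreover have "x \<in> O'" unfolding O'_def using p by (intro image_eqI[of _ _ 0]) auto
  ultimately have "full_orbit X T x \<subseteq> O'" by (intro full_orbit_subset)
  moreover have "finite O'" by (simp add: O'_def)
  ultimately have "finite (full_orbit X T x)" by (rule finite_subset)
  then have "finite (closure (full_orbit X T x))" by (simp add: finite_imp_closed)
  then have "finite X" using full_orbit_dense[OF x] finite_subset by blast
  then show False using zero_in by (simp add: infinite_Ico)
qed

text \<open>The displacement depends only on \<open>word p x\<close>, so it takes finitely many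
  values, none of them 0.\<close>

lemma displacement_bound:
  assumes p: "p \<ge> 1"
  shows "\<exists>t>0. \<forall>x\<in>X. t \<le> \<bar>(T ^^ p) x - x\<bar>"
proof -
  define g where "g x = \<bar>(T ^^ p) x - x\<bar>" for x
  have gw: "g x = g y" if "word p x = word p y" for x y
    using word_translation[OF that, of p] by (simp add: g_def)
  have "g ` X \<subseteq> (\<lambda>w. g (inv_into X (word p) w)) ` word p ` X"
  proof
    fix r assume "r \<in> g ` X"
    then obtain x where x: "x \<in> X" "r = g x" by blast
    have "word p (inv_into X (word p) (word p x)) = word p x"
      using x(1) by (intro f_inv_into_f) auto
    from gw[OF this] show "r \<in> (\<lambda>w. g (inv_into X (word p) w)) ` word p ` X"
      using x by (metis imageI)
  qed
  then have fin: "finite (g ` X)" using words_card(1) finite_surj by (meson finite_imageI finite_subset)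
  have ne: "g ` X \<noteq> {}" using zero_in by blast
  have "0 < g x" if "x \<in> X" for x using aperiodic[OF that p] by (simp add: g_def)
  then have "0 < Min (g ` X)" using Min_in[OF fin ne] by auto
  moreover have "Min (g ` X) \<le> g x" if "x \<in> X" for x using fin that by simp
  ultimately show ?thesis unfolding g_def by blast
qed

text \<open>Suppose that points at distance at least \<open>e\<close> share a long word. By
  pigeonhole some \<open>T ^^ p\<close> shifts the interval between two of their iterates by an
  \<open>s\<close> with \<open>\<bar>s\<bar> < e\<close>. Iterating repeats the same shift until the
  orbit has drifted out of \<open>X\<close>.\<close>

lemma cylinder_small:
  assumes e: "e > 0"
  shows "\<exists>N. \<forall>x\<in>X. \<forall>y\<in>X. word N x = word N y \<longrightarrow> \<bar>y - x\<bar> < e"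
proof -
  obtain P :: nat where P: "real P > l k / e" using reals_Archimedean2 by blast
  have "\<forall>p\<in>{1..P}. \<exists>t>0. \<forall>x\<in>X. t \<le> \<bar>(T ^^ p) x - x\<bar>" using displacement_bound by auto
  then obtain t where t: "\<And>p. p \<in> {1..P} \<Longrightarrow> t p > 0"
    "\<And>p x. p \<in> {1..P} \<Longrightarrow> x \<in> X \<Longrightarrow> t p \<le> \<bar>(T ^^ p) x - x\<bar>" by metis
  define t0 where "t0 = Min (insert 1 (t ` {1..P}))"
  have t0: "0 < t0" "\<And>p x. p \<in> {1..P} \<Longrightarrow> x \<in> X \<Longrightarrow> t0 \<le> \<bar>(T ^^ p) x - x\<bar>"
  proof -
    show "0 < t0" unfolding t0_def by (subst Min_gr_iff) (use t(1) in auto)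
    fix p x assume px: "p \<in> {1..P}" "x \<in> X"
    have "t0 \<le> t p" unfolding t0_def using px by (intro Min_le) auto
    then show "t0 \<le> \<bar>(T ^^ p) x - x\<bar>" using t(2)[OF px] by linarith
  qed
  obtain M :: nat where M: "real M * t0 > l k" using reals_Archimedean3[OF t0(1)] by blast
  have M1: "M \<ge> 1" using M zero_in by (cases M) auto
  \<comment> \<open>\<open>P\<close> steps to reach the close return, then \<open>M\<close> shifts
    of at most \<open>P\<close> steps each.\<close>
  define N where "N = P + P * M"
  have *: False if xy: "x \<in> X" "y \<in> X" "word N x = word N y" "e \<le> y - x" for x y
  proof -
    \<comment> \<open>Number of the box of length \<open>e\<close> containing the
      \<open>j\<close>-th iterate; there are at most \<open>P\<close> boxes for \<open>P + 1\<close>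
      iterates.\<close>
    define b where "b j = nat \<lfloor>(T ^^ j) x / e\<rfloor>" for j
    have "b ` {0..P} \<subseteq> {..<P}"
    proof
      fix r assume "r \<in> b ` {0..P}"
      then obtain j where r: "r = b j" by blast
      have r0: "0 \<le> (T ^^ j) x" "(T ^^ j) x < l k" using Tn_in[OF xy(1), of j] by auto
      then have "(T ^^ j) x / e < l k / e" using e by (simp add: divide_strict_right_mono)
      then have "(T ^^ j) x / e < real P" using P by linarith
      then show "r \<in> {..<P}" unfolding r b_def lessThan_iff using r0 e by (simp add: floor_less_iff nat_less_iff)
    qed
    then have "card (b ` {0..P}) \<le> card {..<P}" by (intro card_mono) auto
    then have "\<not> inj_on b {0..P}" by (auto dest!: card_image)
    then obtain i j where ij: "i < j" "j \<le> P" "b i = b j"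
      unfolding inj_on_def by (metis atLeastAtMost_iff linorder_neqE_nat)
    have "(T ^^ i) x / e \<ge> 0" "(T ^^ j) x / e \<ge> 0"
      using Tn_in[OF xy(1), of i] Tn_in[OF xy(1), of j] e by auto
    then have "\<lfloor>(T ^^ i) x / e\<rfloor> = \<lfloor>(T ^^ j) x / e\<rfloor>"
      using ij(3) unfolding b_def by (metis eq_nat_nat_iff zero_le_floor)
    then have "\<bar>(T ^^ j) x / e - (T ^^ i) x / e\<bar> < 1" by linarith
    then have "\<bar>((T ^^ j) x - (T ^^ i) x) / e\<bar> < 1" by (simp add: diff_divide_distrib)
    then have close: "\<bar>(T ^^ j) x - (T ^^ i) x\<bar> < e" using e by (simp add: abs_divide)
    define p where "p = j - i"
    have p: "p \<in> {1..P}" using ij by (auto simp: p_def)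
    define x' where "x' = (T ^^ i) x"
    define y' where "y' = (T ^^ i) y"
    have X': "x' \<in> X" "y' \<in> X" using Tn_in xy by (auto simp: x'_def y'_def)
    have yx: "y' - x' = y - x"
      using word_translation[OF xy(3), of i] ij by (simp add: x'_def y'_def N_def)
    have w: "word (P * M) x' = word (P * M) y'"
      unfolding x'_def y'_def by (rule word_eq_shift[OF xy(3)]) (use ij in \<open>simp add: N_def\<close>)
    define s where "s = (T ^^ p) x' - x'"
    have s: "\<bar>s\<bar> < e" "t0 \<le> \<bar>s\<bar>"
      using close ij t0(2)[OF p X'(1)] by (auto simp: s_def x'_def p_def Tn_add)
    have tr: "(T ^^ m) z - (T ^^ m) v = z - v"
      if "x' \<le> z" "z \<le> y'" "x' \<le> v" "v \<le> y'" "m \<le> P * M" for z v m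
      using word_translation[OF word_between[OF X' w that(1,2)] that(5)]
        word_translation[OF word_between[OF X' w that(3,4)] that(5)] by simp
    have le: "m * p \<le> P * M" if "m \<le> M" for m
      using mult_le_mono[OF that, of p P] p by (simp add: mult.commute)
    have Mt: "real M * \<bar>s\<bar> > l k"
      using M s(2) mult_left_mono[OF s(2), of "real M"] by linarith
    have "p \<le> P * M" using le[of 1] M1 by simp
    then have py: "(T ^^ p) y' = y' + s"
      using tr[of y' x' p] yx xy(4) e by (simp add: s_def)
    show False
    \<comment> \<open>The drift starts at the endpoint for which one shift by \<open>s\<close>
      remains inside the interval: \<open>x'\<close> if \<open>s > 0\<close>, otherwise
      \<open>y'\<close>.\<close>
    proof (cases "s > 0")
      case True
      have "m \<le> M \<Longrightarrow> (T ^^ (m * p)) x' = x' + real m * s" for m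
      proof (induction m)
        case (Suc m)
        have "(T ^^ (Suc m * p)) x' = (T ^^ (m * p)) (x' + s)"
          using Tn_add[of "m * p" p x'] by (simp add: s_def add.commute)
        also have "\<dots> = (T ^^ (m * p)) x' + s"
          using tr[of "x' + s" x' "m * p"] le[of m] True s(1) yx xy(4) Suc.prems by simp
        finally show ?case using Suc by (simp add: algebra_simps)
      qed simp
      from this[of M] have "x' + real M * s \<in> X" using Tn_in[OF X'(1), of "M * p"] by simp
      then show False using Mt True X'(1) by auto
    next
      case False
      have "m \<le> M \<Longrightarrow> (T ^^ (m * p)) y' = y' + real m * s" for m
      proof (induction m)
        case (Suc m)
        have "(T ^^ (Suc m * p)) y' = (T ^^ (m * p)) (y' + s)"
          using Tn_add[of "m * p" p y'] py by (simp add: add.commute)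
        also have "\<dots> = (T ^^ (m * p)) y' + s"
          using tr[of "y' + s" y' "m * p"] le[of m] False s(1) yx xy(4) Suc.prems by simp
        finally show ?case using Suc by (simp add: algebra_simps)
      qed simp
      from this[of M] have "y' + real M * s \<in> X" using Tn_in[OF X'(2), of "M * p"] by simp
      then show False using Mt False X'(2) by auto
    qed
  qed
  have "\<bar>y - x\<bar> < e" if xy: "x \<in> X" "y \<in> X" "word N x = word N y" for x y
  proof -
    have "\<not> e \<le> y - x" "\<not> e \<le> x - y" using *[OF xy] *[OF xy(2,1) xy(3)[symmetric]] by blast+
    then show ?thesis by linarith
  qed
  then show ?thesis by blast
qed

text \<open>Such an agreement for large \<open>N\<close> would place \<open>x\<close> and
  \<open>(T ^^ p) x\<close> in one short cylinder, against the displacement bound.\<close>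

lemma no_long_periodic_word:
  assumes "p \<ge> 1"
  shows "\<exists>N. \<forall>x\<in>X. word N x \<noteq> word N ((T ^^ p) x)"
proof -
  obtain t where t: "t > 0" "\<And>x. x \<in> X \<Longrightarrow> t \<le> \<bar>(T ^^ p) x - x\<bar>"
    using displacement_bound[OF assms] by blast
  obtain N where N: "\<And>x y. x \<in> X \<Longrightarrow> y \<in> X \<Longrightarrow> word N x = word N y \<Longrightarrow> \<bar>y - x\<bar> < t"
    using cylinder_small[OF t(1)] by blast
  have "word N x \<noteq> word N ((T ^^ p) x)" if "x \<in> X" for x
    using N[OF that Tn_in[OF that]] t(2)[OF that] by fastforce
  then show ?thesis by blast
qed

lemma word_step:
  assumes "x \<in> X" "y \<in> X" "word n x = word n y" "word n x \<notin> right_special n"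
  shows "word n (T x) = word n (T y)"
  using word_eq_shift[OF not_right_special_determines[OF assms], of n 1] by simp

text \<open>Without a branching vertex the path would run around the cycle forever and have a
  periodic itinerary.\<close>

lemma right_special_on_cycle:
  assumes x: "x \<in> X" and ab: "a < b" "word n ((T ^^ a) x) = word n ((T ^^ b) x)" and n: "n \<ge> 1"
  shows "\<exists>t. a \<le> t \<and> t < b \<and> word n ((T ^^ t) x) \<in> right_special n"
proof (rule ccontr)
  assume no: "\<not> ?thesis"
  \<comment> \<open>Both claims need each other: without branching the repetition persists, and from
    time \<open>b\<close> on the words are those of one cycle earlier.\<close>
  have per: "word n ((T ^^ (a + t)) x) = word n ((T ^^ (b + t)) x) \<and>
      word n ((T ^^ (a + t)) x) \<notin> right_special n" for t
  proof (induction t rule: less_induct)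
    case (less t)
    have eq: "word n ((T ^^ (a + t)) x) = word n ((T ^^ (b + t)) x)"
    proof (cases t)
      case 0
      then show ?thesis using ab by simp
    next
      case (Suc u)
      then have "word n (T ((T ^^ (a + u)) x)) = word n (T ((T ^^ (b + u)) x))"
        using less[of u] x by (intro word_step Tn_in) auto
      then show ?thesis using Suc by simp
    qed
    moreover have "word n ((T ^^ (a + t)) x) \<notin> right_special n"
    proof (cases "a + t < b")
      case True
      then show ?thesis using no by auto
    next
      case False
      then have "t - (b - a) < t" "a + t = b + (t - (b - a))" using ab(1) by auto
      then show ?thesis using less[of "t - (b - a)"] by metis
    qed
    ultimately show ?case by simp
  qed
  have pos: "1 \<le> b - a" using ab(1) by simp
  obtain N where N: "\<And>y. y \<in> X \<Longrightarrow> word N y \<noteq> word N ((T ^^ (b - a)) y)"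
    using no_long_periodic_word[of "b - a"] pos by blast
  have "letter ((T ^^ (a + t)) x) = letter ((T ^^ (b + t)) x)" for t
  proof -
    have "word n ((T ^^ (a + t)) x) ! 0 = word n ((T ^^ (b + t)) x) ! 0" using per by simp
    then show ?thesis using n by simp
  qed
  then have "word N ((T ^^ a) x) = word N ((T ^^ (b - a)) ((T ^^ a) x))"
    using ab(1) by (simp add: word_eq_iff Tn_add add.commute)
  then show False using N Tn_in[OF x] by blast
qed

text \<open>There are fewer words than times considered, so a word repeats and closes a
  cycle.\<close>

lemma right_special_visit:
  assumes x: "x \<in> X" and n: "n \<ge> 1"
  shows "\<exists>t\<le>(k - 1) * n + 1. word n ((T ^^ t) x) \<in> right_special n"
proof -
  define M where "M = (k - 1) * n + 1"
  define v where "v t = word n ((T ^^ t) x)" for t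
  have "card (v ` {0..M}) \<le> card (word n ` X)"
    using words_card(1) Tn_in[OF x] by (intro card_mono) (auto simp: v_def)
  then have "card (v ` {0..M}) \<le> M" using words_card(2)[of n] by (simp add: M_def)
  then have "\<not> inj_on v {0..M}" by (auto dest!: card_image)
  then obtain i j where ij: "i < j" "j \<le> M" "v i = v j"
    unfolding inj_on_def by (metis atLeastAtMost_iff linorder_neqE_nat)
  then obtain t where "i \<le> t" "t < j" "v t \<in> right_special n"
    using right_special_on_cycle[OF x ij(1) _ n] unfolding v_def by blast
  then show ?thesis using ij(2) unfolding v_def M_def by (intro exI[of _ t]) auto
qed

section \<open>Rauzy graphs with separated right special words\<close>

text \<open>If the right special words of length \<open>n\<close> are far from each other in the Rauzy graph, then
  the vertices on the shortest paths leaving them nearly exhaust the graph. This leaves no room for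
  the second branch at a right special word, which must come back or merge almost at once.\<close>

lemma right_special_almost_periodic:
  fixes \<rho> :: "'i \<Rightarrow> nat list"
  assumes k: "k > 2" and I: "finite I" "card I = k - 1" "\<rho> ` I = right_special n"
    and M: "M \<le> n" "n div 8 < M" "(k - 1) * n + 1 < (k - 1) * M + n div 8"
    and sep: "\<And>i j x y s t. i \<in> I \<Longrightarrow> j \<in> I \<Longrightarrow> i \<noteq> j \<Longrightarrow> x \<in> X \<Longrightarrow> y \<in> X \<Longrightarrow> word n x = \<rho> i \<Longrightarrow>
      word n y = \<rho> j \<Longrightarrow> s \<le> n \<Longrightarrow> t \<le> n \<Longrightarrow> word n ((T ^^ s) x) = word n ((T ^^ t) y) \<Longrightarrow> M \<le> max s t"
    and w: "w \<in> right_special n"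
  shows "\<exists>a b. a < b \<and> 8 * b \<le> n \<and> (\<forall>t. b + t < n \<longrightarrow> w ! (a + t) = w ! (b + t))"
proof (rule ccontr)
  assume fail: "\<not> ?thesis"
  have n: "n \<ge> 1" and M1: "M \<ge> 1" using M by linarith+
  define R where "R = right_special n"
  have \<rho>R: "\<rho> i \<in> R" if "i \<in> I" for i using I that by (auto simp: R_def)
  have \<rho>_word: "\<exists>x\<in>X. word n x = \<rho> i" if "i \<in> I" for i
    using subsetD[OF right_special_words \<rho>R[OF that, unfolded R_def]] by fastforce
  have \<rho>_inj: "\<rho> i \<noteq> \<rho> j" if ij: "i \<in> I" "j \<in> I" "i \<noteq> j" for i j
  proof
    assume eq: "\<rho> i = \<rho> j"
    obtain x where "x \<in> X" "word n x = \<rho> i" using \<rho>_word ij(1) by blast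
    then show False using sep[OF ij, of x x 0 0] eq M1 by simp
  qed
  have follow: "word n ((T ^^ t) y) = word n ((T ^^ t) x)"
    if "x \<in> X" "y \<in> X" "word n y = word n x" "t \<le> m" "\<And>t. t < m \<Longrightarrow> word n ((T ^^ t) x) \<notin> R" for x y t m
    using that(4)
  proof (induction t)
    case (Suc t)
    then have "word n (T ((T ^^ t) x)) = word n (T ((T ^^ t) y))"
      using that by (intro word_step Tn_in) (auto simp: R_def)
    then show ?case by simp
  qed (use that in simp)
  \<comment> \<open>The first right special word on the path of \<open>x\<close>, its starting word
    included.\<close>
  define hits where "hits x w \<longleftrightarrow> (\<exists>m. word n ((T ^^ m) x) = w \<and> w \<in> R \<and> (\<forall>t<m. word n ((T ^^ t) x) \<notin> R))"
    for x w
  have hits_total: "\<exists>w. hits x w" if x: "x \<in> X" for x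
  proof -
    obtain t where t: "word n ((T ^^ t) x) \<in> R"
      using right_special_visit[OF x n] unfolding R_def by blast
    define m where "m = (LEAST m. word n ((T ^^ m) x) \<in> R)"
    have "word n ((T ^^ m) x) \<in> R" unfolding m_def by (rule LeastI[of _ t]) (rule t)
    moreover have "word n ((T ^^ t) x) \<notin> R" if "t < m" for t
      using not_less_Least that unfolding m_def by blast
    ultimately show ?thesis unfolding hits_def by blast
  qed
  have hits_word: "hits y w" if xy: "x \<in> X" "y \<in> X" "word n y = word n x" "hits x w" for x y w
  proof -
    obtain m where m: "word n ((T ^^ m) x) = w" "w \<in> R" "\<And>t. t < m \<Longrightarrow> word n ((T ^^ t) x) \<notin> R"
      using xy(4) unfolding hits_def by blast
    have "word n ((T ^^ t) y) = word n ((T ^^ t) x)" if "t \<le> m" for t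
      by (rule follow[OF xy(1-3) that m(3)])
    then show ?thesis unfolding hits_def using m by (intro exI[of _ m]) auto
  qed
  \<comment> \<open>An escape from \<open>\<rho> i\<close>: after the start, the first right special
    word met is a different one, at time \<open>\<tau>\<close>.\<close>
  define leaves where "leaves i x \<tau> \<longleftrightarrow> x \<in> X \<and> word n x = \<rho> i \<and> 1 \<le> \<tau> \<and>
    (\<forall>t. 1 \<le> t \<longrightarrow> t < \<tau> \<longrightarrow> word n ((T ^^ t) x) \<notin> R) \<and> word n ((T ^^ \<tau>) x) \<in> R \<and> word n ((T ^^ \<tau>) x) \<noteq> \<rho> i"
    for i x \<tau>
  \<comment> \<open>Without an escape, the words whose first right special word is
    \<open>\<rho> i\<close> form a set closed under edges. It would then contain all words, among
    them another \<open>\<rho> j\<close>, whose first right special word is itself.\<close>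
  have ex_leaves: "\<exists>\<tau> x. leaves i x \<tau>" if i: "i \<in> I" for i
  proof (rule ccontr)
    assume no: "\<not> ?thesis"
    have ret: "hits (T x) (\<rho> i)" if x: "x \<in> X" "word n x = \<rho> i" for x
    proof -
      obtain w where w: "hits (T x) w" using hits_total[OF T_in[OF x(1)]] by blast
      then obtain m where m: "word n ((T ^^ m) (T x)) = w" "w \<in> R"
        "\<And>t. t < m \<Longrightarrow> word n ((T ^^ t) (T x)) \<notin> R" unfolding hits_def by blast
      have "w = \<rho> i"
      proof (rule ccontr)
        assume "w \<noteq> \<rho> i"
        moreover have "(T ^^ t) (T x) = (T ^^ Suc t) x" for t by (simp add: funpow_swap1)
        moreover have "word n ((T ^^ t) x) \<notin> R" if t: "1 \<le> t" "t < Suc m" for t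
        proof -
          obtain t' where t': "t = Suc t'" using t(1) by (cases t) auto
          show ?thesis using m(3)[of t'] t(2) calculation(2)[of t'] t' by simp
        qed
        ultimately have "leaves i x (Suc m)"
          unfolding leaves_def using m(1,2) x by (metis le_add1 plus_1_eq_Suc)
        then show False using no by blast
      qed
      then show ?thesis using w by simp
    qed
    define S where "S = {v. \<exists>y\<in>X. word n y = v \<and> hits y (\<rho> i)}"
    have S_iff: "word n y \<in> S \<longleftrightarrow> hits y (\<rho> i)" if y: "y \<in> X" for y
    proof
      assume "word n y \<in> S"
      then obtain y' where "y' \<in> X" "word n y' = word n y" "hits y' (\<rho> i)"
        unfolding S_def mem_Collect_eq by (elim bexE conjE)
      then show "hits y (\<rho> i)" using hits_word[of y' y "\<rho> i"] y by simp
    next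
      assume "hits y (\<rho> i)"
      then show "word n y \<in> S" unfolding S_def mem_Collect_eq using y by (intro bexI[of _ y] conjI refl)
    qed
    have closed: "word n (T y) \<in> S" if y: "y \<in> X" "word n y \<in> S" for y
    proof -
      obtain m where m: "word n ((T ^^ m) y) = \<rho> i" "\<And>t. t < m \<Longrightarrow> word n ((T ^^ t) y) \<notin> R"
        using y(2) unfolding S_iff[OF y(1)] hits_def by blast
      have "hits (T y) (\<rho> i)"
      proof (cases m)
        case 0
        then show ?thesis using ret y m by simp
      next
        case (Suc m')
        have "word n ((T ^^ t) (T y)) \<notin> R" if "t < m'" for t
          using m(2)[of "Suc t"] that Suc by (simp add: funpow_swap1)
        then show ?thesis unfolding hits_def using m(1) Suc \<rho>R[OF i]
          by (intro exI[of _ m']) (auto simp: funpow_swap1)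
      qed
      then show ?thesis using S_iff[OF T_in[OF y(1)]] by simp
    qed
    obtain x where x: "x \<in> X" "word n x = \<rho> i" using \<rho>_word[OF i] by blast
    have "hits x (\<rho> i)" unfolding hits_def using x \<rho>R[OF i] by (intro exI[of _ 0]) auto
    then have xS: "word n x \<in> S" using S_iff[OF x(1)] by simp
    have "\<not> I \<subseteq> {i}" using card_mono[of "{i}" I] I k by auto
    then obtain j where j: "j \<in> I" "j \<noteq> i" by blast
    obtain y where y: "y \<in> X" "word n y = \<rho> j" using \<rho>_word[OF j(1)] by blast
    have "hits y (\<rho> i)" using closed_words_full[OF x(1) xS closed y(1)] S_iff[OF y(1)] by simp
    then obtain m where m: "word n ((T ^^ m) y) = \<rho> i" "\<And>t. t < m \<Longrightarrow> word n ((T ^^ t) y) \<notin> R"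
      unfolding hits_def by blast
    have "m = 0" using m(2)[of 0] y \<rho>R[OF j(1)] by (cases m) auto
    then show False using m(1) y \<rho>_inj[OF i j(1)] j(2) by simp
  qed
  \<comment> \<open>A shortest escape is fixed for each \<open>i\<close>; minimality later excludes
    that the second branch is a shortcut.\<close>
  have "\<exists>\<tau> x. leaves i x \<tau> \<and> (\<forall>y \<tau>'. leaves i y \<tau>' \<longrightarrow> \<tau> \<le> \<tau>')" if i: "i \<in> I" for i
  proof -
    define \<tau> where "\<tau> = (LEAST \<tau>. \<exists>x. leaves i x \<tau>)"
    have "\<exists>x. leaves i x \<tau>" unfolding \<tau>_def by (rule LeastI_ex[OF ex_leaves[OF i]])
    moreover have "\<tau> \<le> \<tau>'" if "leaves i y \<tau>'" for y \<tau>'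
      unfolding \<tau>_def by (rule Least_le) (use that in blast)
    ultimately show ?thesis by blast
  qed
  then obtain \<tau> \<xi> where leav: "\<And>i. i \<in> I \<Longrightarrow> leaves i (\<xi> i) (\<tau> i)"
    and shortest: "\<And>i y \<tau>'. i \<in> I \<Longrightarrow> leaves i y \<tau>' \<Longrightarrow> \<tau> i \<le> \<tau>'" by metis
  have \<xi>: "\<xi> i \<in> X" "word n (\<xi> i) = \<rho> i" "\<tau> i \<ge> 1"
    "\<And>t. 1 \<le> t \<Longrightarrow> t < \<tau> i \<Longrightarrow> word n ((T ^^ t) (\<xi> i)) \<notin> R"
    "word n ((T ^^ \<tau> i) (\<xi> i)) \<in> R" "word n ((T ^^ \<tau> i) (\<xi> i)) \<noteq> \<rho> i" if "i \<in> I" for i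
    using leav[OF that] unfolding leaves_def by blast+
  have far: "M \<le> s" if x: "x \<in> X" "word n x = \<rho> i" "i \<in> I" "word n ((T ^^ s) x) \<in> R"
    "word n ((T ^^ s) x) \<noteq> \<rho> i" for i x s
  proof (cases "s \<le> n")
    case True
    obtain j where j: "j \<in> I" "word n ((T ^^ s) x) = \<rho> j" using x(4) I(3) unfolding R_def by (metis imageE)
    have "j \<noteq> i" using j x by auto
    from sep[OF x(3) j(1) this[symmetric] x(1) Tn_in[OF x(1)] x(2) j(2) True, of 0] show ?thesis by simp
  qed (use M in simp)
  have \<tau>M: "M \<le> \<tau> i" if "i \<in> I" for i using far \<xi>[OF that] that by blast
  \<comment> \<open>The first \<open>M\<close> vertices of each escape path. Those of different
    paths are distinct by \<open>sep\<close>; a repetition on one path would force an early return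
    to \<open>\<rho> i\<close>.\<close>
  define v where "v = (\<lambda>(i, s). word n ((T ^^ s) (\<xi> i)))"
  have v_inj: "inj_on v (I \<times> {..<M})"
  proof -
    have *: False if st: "i \<in> I" "s < t" "t < M" "v (i, s) = v (i, t)" for i s t
    proof -
      obtain r where r: "s \<le> r" "r < t" "word n ((T ^^ r) (\<xi> i)) \<in> R"
        using right_special_on_cycle[OF \<xi>(1)[OF st(1)] st(2) _ n] st(4) unfolding R_def v_def by auto
      then have "r = 0" using \<xi>(4)[OF that(1), of r] that \<tau>M[OF that(1)] by (cases r) auto
      then have "v (i, t) = \<rho> i" using that r \<xi>(2)[OF that(1)] by (simp add: v_def)
      then show False
        using \<xi>(4)[OF that(1), of t] that \<tau>M[OF that(1)] \<rho>R[OF that(1)] by (simp add: v_def)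
    qed
    show ?thesis
    proof (rule inj_onI)
      fix p q assume pq: "p \<in> I \<times> {..<M}" "q \<in> I \<times> {..<M}" "v p = v q"
      obtain i s j t where ij: "p = (i, s)" "q = (j, t)" by (cases p, cases q)
      have st: "i \<in> I" "j \<in> I" "s < M" "t < M" using pq ij by auto
      have "i = j"
      proof (rule ccontr)
        assume "i \<noteq> j"
        from sep[OF st(1,2) this \<xi>(1)[OF st(1)] \<xi>(1)[OF st(2)] \<xi>(2)[OF st(1)] \<xi>(2)[OF st(2)], of s t]
        show False using pq(3) st M(1) by (auto simp: v_def ij)
      qed
      moreover have "s = t"
        using *[OF st(1), of s t] *[OF st(1), of t s] st pq(3) calculation unfolding ij
        by (metis linorder_neqE_nat)
      ultimately show "p = q" using ij by simp
    qed
  qed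
  have not_period: False
    if "a < b" "b \<le> n div 8" "\<And>t. b + t < n \<Longrightarrow> w ! (a + t) = w ! (b + t)" for a b
  proof -
    have "8 * b \<le> n" using that(2) by linarith
    then show False using fail that by blast
  qed
  obtain h where h: "h \<in> I" "w = \<rho> h" using w I(3) by (metis imageE)
  \<comment> \<open>Since \<open>w\<close> has two possible next letters, one of them differs from
    the letter that the escape path of \<open>\<xi> h\<close> takes. The path \<open>u\<close> of
    \<open>x\<close> is the second branch.\<close>
  obtain x where x: "x \<in> X" "word n x = w" "letter ((T ^^ n) x) \<noteq> letter ((T ^^ n) (\<xi> h))"
    using w unfolding right_special_def mem_Collect_eq by metis
  have w_x: "w ! t = letter ((T ^^ t) x)" if "t < n" for t using x(2) that by auto
  have w_\<xi>: "w ! t = letter ((T ^^ t) (\<xi> h))" if "t < n" for t using \<xi>(2)[OF h(1)] h(2) that by (metis word_nth)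
  define u where "u s = word n ((T ^^ s) x)" for s
  have u_nth: "u s ! t = letter ((T ^^ (s + t)) x)" if "t < n" for s t
    using that by (simp add: u_def Tn_add add.commute)
  have v_nth: "v (i, s) ! t = letter ((T ^^ (s + t)) (\<xi> i))" if "t < n" for i s t
    using that by (simp add: v_def Tn_add add.commute)
  \<comment> \<open>Coming back to \<open>w\<close> within \<open>n div 8\<close> steps would give
    \<open>w\<close> a short period, and any other right special word is at least \<open>M\<close>
    steps away.\<close>
  have uR: "u s \<notin> R" if s: "1 \<le> s" "s \<le> n div 8" for s
  proof
    assume a: "u s \<in> R"
    have us: "u s = w"
    proof (rule ccontr)
      assume "u s \<noteq> w"
      then have "M \<le> s" using far[OF x(1) _ h(1), of s] a x(2) h(2) by (simp add: u_def)
      then show False using s M by simp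
    qed
    have "w ! (0 + t) = w ! (s + t)" if "s + t < n" for t
      using w_x[of "s + t"] u_nth[of t s] us that by simp
    then show False using not_period[of 0 s] s by simp
  qed
  have u_inj: "inj_on u {1..n div 8}"
  proof -
    have *: False if st: "s < t" "1 \<le> s" "t \<le> n div 8" "u s = u t" for s t
    proof -
      obtain r where "s \<le> r" "r < t" "u r \<in> R"
        using right_special_on_cycle[OF x(1) st(1) _ n] st(4) unfolding R_def u_def by auto
      then show False using uR[of r] that by simp
    qed
    show ?thesis
    proof (rule inj_onI)
      fix s t assume "s \<in> {1..n div 8}" "t \<in> {1..n div 8}" "u s = u t"
      then show "s = t" using *[of s t] *[of t s] by (cases s t rule: linorder_cases) auto
    qed
  qed
  \<comment> \<open>Paths of other indices are excluded by \<open>sep\<close>. On the path of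
    \<open>h\<close> itself, \<open>s = t\<close> contradicts the different next letters,
    \<open>t < s\<close> makes \<open>w\<close> almost periodic, and \<open>s < t\<close> gives an
    escape shorter than the shortest.\<close>
  have uv: "u s \<noteq> v (i, t)" if s: "1 \<le> s" "s \<le> n div 8" and t: "i \<in> I" "t < M" for s i t
  proof
    assume eq: "u s = v (i, t)"
    have sn: "s < M" "s \<le> n" "t \<le> n" using s t M by auto
    have ih: "i = h"
    proof (rule ccontr)
      assume "i \<noteq> h"
      from sep[OF h(1) t(1) this[symmetric] x(1) \<xi>(1)[OF t(1)] _ \<xi>(2)[OF t(1)] sn(2,3)] eq x(2) h(2)
      have "M \<le> max s t" by (auto simp: u_def v_def)
      then show False using sn t by simp
    qed
    have t0: "t \<noteq> 0"
    proof
      assume "t = 0"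
      then have "u s = \<rho> h" using eq ih \<xi>(2)[OF h(1)] by (simp add: v_def)
      then show False using uR[OF s] \<rho>R[OF h(1)] by simp
    qed
    consider "s = t" | "t < s" | "s < t" by linarith
    then show False
    proof cases
      case 1
      have "letter ((T ^^ n) x) = letter ((T ^^ n) (\<xi> h))"
        using u_nth[of "n - s" s] v_nth[of "n - s" i t] eq ih 1 sn s by simp
      then show False using x(3) by simp
    next
      case 2
      have "w ! (t + r) = w ! (s + r)" if "s + r < n" for r
        using w_x[of "s + r"] w_\<xi>[of "t + r"] u_nth[of r s] v_nth[of r i t] eq ih that 2 by simp
      then show False using not_period[OF 2 s(2)] by blast
    next
      case 3
      have t\<tau>: "t < \<tau> h" using \<tau>M[OF h(1)] t(2) by simp
      have fol: "word n ((T ^^ (s + r)) x) = word n ((T ^^ (t + r)) (\<xi> h))" if "r \<le> \<tau> h - t" for r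
      proof -
        have "word n ((T ^^ r) ((T ^^ s) x)) = word n ((T ^^ r) ((T ^^ t) (\<xi> h)))"
        proof (rule follow[OF _ _ _ that])
          show "word n ((T ^^ s) x) = word n ((T ^^ t) (\<xi> h))" using eq ih by (simp add: u_def v_def)
          fix r assume "r < \<tau> h - t"
          then show "word n ((T ^^ r) ((T ^^ t) (\<xi> h))) \<notin> R"
            using \<xi>(4)[OF h(1), of "t + r"] t0 by (simp add: Tn_add add.commute)
        qed (use x \<xi>(1)[OF h(1)] Tn_in in blast)+
        then show ?thesis by (simp add: Tn_add add.commute)
      qed
      have "leaves h x (s + (\<tau> h - t))"
        unfolding leaves_def
      proof (intro conjI allI impI)
        fix r assume r: "1 \<le> r" "r < s + (\<tau> h - t)"
        show "word n ((T ^^ r) x) \<notin> R"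
        proof (cases "r \<le> s")
          case True
          then show ?thesis using uR[of r] r s by (simp add: u_def)
        next
          case False
          then show ?thesis using fol[of "r - s"] \<xi>(4)[OF h(1), of "t + (r - s)"] r by simp
        qed
      qed (use x h s t\<tau> fol[of "\<tau> h - t"] \<xi>(5,6)[OF h(1)] in auto)
      then have "\<tau> h \<le> s + (\<tau> h - t)" by (rule shortest[OF h(1)])
      then show False using 3 t\<tau> by simp
    qed
  qed
  \<comment> \<open>The escape paths and the second branch together have more vertices than there
    are words.\<close>
  have "v ` (I \<times> {..<M}) \<inter> u ` {1..n div 8} = {}" using uv by fastforce
  moreover have "v ` (I \<times> {..<M}) \<union> u ` {1..n div 8} \<subseteq> word n ` X"
    using \<xi>(1) x(1) Tn_in by (auto simp: v_def u_def)
  ultimately have "card (v ` (I \<times> {..<M})) + card (u ` {1..n div 8}) \<le> card (word n ` X)"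
    using I(1) words_card(1)[of n] by (subst card_Un_disjoint[symmetric]) (auto intro!: card_mono)
  then have "(k - 1) * M + n div 8 \<le> card (word n ` X)"
    using v_inj u_inj I by (simp add: card_image card_cartesian_product)
  then show False using words_card(2)[of n] M(3) by simp
qed

text \<open>Separation at all large scales makes the word of \<open>past n (l 1)\<close> right
  special, hence almost periodic, for every large \<open>n\<close>. These periods combine to one
  period of the whole past of \<open>l 1\<close>.\<close>

lemma right_special_not_separated:
  fixes I :: "'i set"
  assumes k: "k > 2" and I: "finite I" "card I = k - 1"
    and sep: "\<And>n. n \<ge> n0 \<Longrightarrow> \<exists>M \<rho>. \<rho> ` I \<subseteq> right_special n \<and> M \<le> n \<and> n div 8 < M \<and>
      (k - 1) * n + 1 < (k - 1) * M + n div 8 \<and>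
      (\<forall>i\<in>I. \<forall>j\<in>I. i \<noteq> j \<longrightarrow> (\<forall>x\<in>X. \<forall>y\<in>X. word n x = \<rho> i \<longrightarrow> word n y = \<rho> j \<longrightarrow>
        (\<forall>s\<le>n. \<forall>t\<le>n. word n ((T ^^ s) x) = word n ((T ^^ t) y) \<longrightarrow> M \<le> max s t)))"
  shows False
proof -
  have l1: "l 1 \<in> X" using cut_in[of 1] k by simp
  have per: "\<exists>a b. a < b \<and> 8 * b \<le> n \<and>
      (\<forall>t. b + t < n \<longrightarrow> word n (past n (l 1)) ! (a + t) = word n (past n (l 1)) ! (b + t))"
    if n: "n \<ge> n0" for n
  proof -
    obtain M \<rho> where h: "\<rho> ` I \<subseteq> right_special n" "M \<le> n" "n div 8 < M"
      "(k - 1) * n + 1 < (k - 1) * M + n div 8"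
      "\<And>i j x y s t. i \<in> I \<Longrightarrow> j \<in> I \<Longrightarrow> i \<noteq> j \<Longrightarrow> x \<in> X \<Longrightarrow> y \<in> X \<Longrightarrow> word n x = \<rho> i \<Longrightarrow>
        word n y = \<rho> j \<Longrightarrow> s \<le> n \<Longrightarrow> t \<le> n \<Longrightarrow> word n ((T ^^ s) x) = word n ((T ^^ t) y) \<Longrightarrow> M \<le> max s t"
      using sep[OF n] by metis
    \<comment> \<open>There are at most \<open>k - 1\<close> candidates for right special words, and
      \<open>\<rho>\<close> injects \<open>k - 1\<close> indices into them, so every candidate is
      right special.\<close>
    define c where "c = (\<lambda>s. word n (past n (l s))) ` {1..k-1}"
    have fin: "finite c" and card_c: "card c \<le> k - 1"
      using card_image_le[of "{1..k-1}" "\<lambda>s. word n (past n (l s))"] by (auto simp: c_def)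
    have sub: "\<rho> ` I \<subseteq> c" "right_special n \<subseteq> c"
      using h(1) right_special_subset[of n] by (auto simp: c_def)
    have "inj_on \<rho> I"
    proof (rule inj_onI, rule ccontr)
      fix i j assume ij: "i \<in> I" "j \<in> I" "\<rho> i = \<rho> j" "i \<noteq> j"
      have "\<rho> i \<in> word n ` X" using h(1) ij(1) right_special_words by blast
      then obtain x where "x \<in> X" "word n x = \<rho> i" by auto
      then show False using h(5)[OF ij(1,2,4), of x x 0 0] h(3) ij(3) by simp
    qed
    then have "card (\<rho> ` I) = k - 1" using I by (simp add: card_image)
    then have "\<rho> ` I = c" using card_seteq[OF fin sub(1)] card_c by simp
    then have eq: "\<rho> ` I = right_special n" using h(1) sub by blast
    have "word n (past n (l 1)) \<in> right_special n"
      unfolding eq[symmetric] \<open>\<rho> ` I = c\<close> c_def using k by (intro image_eqI[of _ _ 1]) auto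
    from right_special_almost_periodic[OF k I eq h(2-4) _ this] h(5)
    show ?thesis by presburger
  qed
  \<comment> \<open>Read backwards from \<open>l 1\<close>, the words of \<open>past n (l 1)\<close>
    for all \<open>n\<close> become prefixes of one sequence.\<close>
  define z where "z j = letter (past (Suc j) (l 1))" for j
  have wz: "word n (past n (l 1)) ! m = z (n - 1 - m)" if "m < n" for n m
    using that Tn_past_le[OF l1, of m n] by (simp add: z_def Suc_diff_Suc)
  have "\<exists>p\<ge>1. 4 * p \<le> m \<and> (\<forall>j. j + p < m \<longrightarrow> z j = z (j + p))" if m: "m \<ge> n0" for m
  proof -
    \<comment> \<open>In length \<open>2 * m\<close>, the initial \<open>a\<close> letters that
      escape the period lie in the remotest past, beyond the first \<open>m\<close> entries of
      \<open>z\<close>, and \<open>4 * b \<le> m\<close>.\<close>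
    obtain a b where ab: "a < b" "8 * b \<le> 2 * m" "\<And>t. b + t < 2 * m \<Longrightarrow>
      word (2 * m) (past (2 * m) (l 1)) ! (a + t) = word (2 * m) (past (2 * m) (l 1)) ! (b + t)"
      using per[of "2 * m"] m by auto
    have "z j = z (j + (b - a))" if j: "j + (b - a) < m" for j
    proof -
      define t where "t = 2 * m - 1 - b - j"
      have t: "b + t < 2 * m" "a + t < 2 * m" "2 * m - 1 - (b + t) = j" "2 * m - 1 - (a + t) = j + (b - a)"
        using j ab(1,2) by (auto simp: t_def)
      show ?thesis using ab(3)[OF t(1)] wz[OF t(1)] wz[OF t(2)] t(3,4) by simp
    qed
    then show ?thesis using ab(1,2) by (intro exI[of _ "b - a"]) auto
  qed
  then have "\<exists>p\<ge>1. \<forall>j. z j = z (j + p)" by (rule nested_periods)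
  then obtain p where p: "p \<ge> 1" "\<forall>j. z j = z (j + p)" by (elim exE conjE)
  obtain N where N: "\<And>x. x \<in> X \<Longrightarrow> word N x \<noteq> word N ((T ^^ p) x)"
    using no_long_periodic_word[OF p(1)] by blast
  \<comment> \<open>The first \<open>N + p\<close> letters of this point all lie in the periodic
    past of \<open>l 1\<close>.\<close>
  define x where "x = past (N + p) (l 1)"
  have "letter ((T ^^ t) x) = letter ((T ^^ t) ((T ^^ p) x))" if "t < N" for t
  proof -
    have "letter ((T ^^ t) x) = z (N - 1 - t + p)"
    proof -
      have "N + p - t = Suc (N - 1 - t + p)" using that by simp
      then show ?thesis using Tn_past_le[OF l1, of t "N + p"] that by (simp add: x_def z_def)
    qed
    also have "\<dots> = z (N - 1 - t)" using p(2)[rule_format, of "N - 1 - t"] by (rule sym)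
    also have "\<dots> = letter ((T ^^ (t + p)) x)"
    proof -
      have "N + p - (t + p) = Suc (N - 1 - t)" using that by simp
      then show ?thesis using Tn_past_le[OF l1, of "t + p" "N + p"] that by (simp add: x_def z_def)
    qed
    finally show ?thesis by (simp add: Tn_add)
  qed
  then show False using N[of x] past_in[OF l1] by (simp add: x_def word_eq_iff)
qed

section \<open>Generic measures\<close>

text \<open>Points of a long cylinder are close, and their distance is unchanged for
  \<open>n\<close> steps, so uniform continuity applies at all these times.\<close>

lemma continuous_along_cylinders:
  assumes f: "continuous_on {0..l k} f" and e: "e > (0 :: real)"
  shows "\<exists>n0. \<forall>n\<ge>n0. \<forall>x\<in>X. \<forall>y\<in>X. word n x = word n y \<longrightarrow>
    (\<forall>j\<le>n. \<bar>f ((T ^^ j) y) - f ((T ^^ j) x)\<bar> \<le> e)"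
proof -
  have "uniformly_continuous_on {0..l k} f" by (rule compact_uniformly_continuous[OF f]) simp
  then obtain d where d: "d > 0" "\<And>u v. u \<in> {0..l k} \<Longrightarrow> v \<in> {0..l k} \<Longrightarrow> dist v u < d \<Longrightarrow> dist (f v) (f u) < e"
    using e unfolding uniformly_continuous_on_def by meson
  obtain N where N: "\<And>x y. x \<in> X \<Longrightarrow> y \<in> X \<Longrightarrow> word N x = word N y \<Longrightarrow> \<bar>y - x\<bar> < d"
    using cylinder_small[OF d(1)] by blast
  have "\<bar>f ((T ^^ j) y) - f ((T ^^ j) x)\<bar> \<le> e"
    if "n \<ge> N" "x \<in> X" "y \<in> X" "word n x = word n y" "j \<le> n" for n x y j
  proof -
    have "\<bar>y - x\<bar> < d" using N[OF that(2,3) word_eq_le[OF that(4,1)]] .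
    then have "dist ((T ^^ j) y) ((T ^^ j) x) < d"
      using word_translation[OF that(4,5)] by (simp add: dist_real_def)
    then have "dist (f ((T ^^ j) y)) (f ((T ^^ j) x)) < e"
      using Tn_in[OF that(2), of j] Tn_in[OF that(3), of j] by (intro d(2)) auto
    then show ?thesis by (simp add: dist_real_def)
  qed
  then show ?thesis by blast
qed

text \<open>Right special words met by orbits with different averages are separated in the Rauzy
  graph: a long overlap of their paths would force nearly equal Birkhoff sums.\<close>

lemma no_separated_averages:
  fixes I :: "'i set" and x :: "'i \<Rightarrow> real" and a :: "'i \<Rightarrow> real"
  assumes k: "k > 2" and I: "finite I" "card I = k - 1"
    and x: "\<And>i. i \<in> I \<Longrightarrow> x i \<in> X"
    and f: "continuous_on {0..l k} f"
    and lim: "\<And>i. i \<in> I \<Longrightarrow> (\<lambda>N. (1 / real N) * (\<Sum>n<N. f ((T ^^ n) (x i)))) \<longlonglongrightarrow> a i"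
    and inj: "inj_on a I"
  shows False
proof -
  define K where "K = k - 1"
  have K: "K \<ge> 2" using k by (simp add: K_def)
  define D where "D = Min ((\<lambda>(i, j). \<bar>a i - a j\<bar>) ` {(i, j) \<in> I \<times> I. i \<noteq> j})"
  have fin: "finite ((\<lambda>(i, j). \<bar>a i - a j\<bar>) ` {(i, j) \<in> I \<times> I. i \<noteq> j})"
    by (rule finite_imageI, rule finite_subset[of _ "I \<times> I"]) (use I(1) in auto)
  have "\<exists>i\<in>I. \<exists>j\<in>I. i \<noteq> j"
  proof -
    obtain i where i: "i \<in> I" using I K by (cases "I = {}") (auto simp: K_def)
    have "\<not> I \<subseteq> {i}" using card_mono[of "{i}" I] I k by auto
    then show ?thesis using i by blast
  qed
  then have ne: "(\<lambda>(i, j). \<bar>a i - a j\<bar>) ` {(i, j) \<in> I \<times> I. i \<noteq> j} \<noteq> {}" by auto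
  have D0: "D > 0" using Min_in[OF fin ne] inj unfolding D_def[symmetric] by (auto dest: inj_onD)
  have D: "D \<le> \<bar>a i - a j\<bar>" if "i \<in> I" "j \<in> I" "i \<noteq> j" for i j
    unfolding D_def by (rule Min_le[OF fin]) (use that in force)
  \<comment> \<open>As 96 is 6 times 16, an overlap of more than \<open>n / (16 * K)\<close> steps
    has a gap in sums exceeding the total error \<open>5 * e * n\<close>.\<close>
  define e where "e = D / (96 * real K)"
  have e: "e > 0" using D0 K by (simp add: e_def)
  have "\<forall>i\<in>I. \<exists>n0. \<forall>n\<ge>n0. \<forall>p q. p \<le> q \<longrightarrow> q \<le> (K + 2) * n \<longrightarrow>
      \<bar>\<Sum>j=p..<q. f ((T ^^ j) (x i)) - a i\<bar> \<le> e * real n"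
    using average_segments[OF lim e] by blast
  then obtain n1 where n1: "\<And>i n p q. i \<in> I \<Longrightarrow> n \<ge> n1 i \<Longrightarrow> p \<le> q \<Longrightarrow> q \<le> (K + 2) * n \<Longrightarrow>
      \<bar>\<Sum>j=p..<q. f ((T ^^ j) (x i)) - a i\<bar> \<le> e * real n"
    by metis
  obtain n2 where n2: "\<And>n y z j. n \<ge> n2 \<Longrightarrow> y \<in> X \<Longrightarrow> z \<in> X \<Longrightarrow> word n y = word n z \<Longrightarrow> j \<le> n \<Longrightarrow>
      \<bar>f ((T ^^ j) z) - f ((T ^^ j) y)\<bar> \<le> e"
    using continuous_along_cylinders[OF f e] by blast
  define n0 where "n0 = Max (insert (n2 + 64) (n1 ` I))"
  show False
  proof (rule right_special_not_separated[OF k I])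
    fix n assume n: "n \<ge> n0"
    have n1n: "n \<ge> n1 i" if "i \<in> I" for i
      using n that I(1) unfolding n0_def by (auto simp: Max_le_iff intro: le_trans[rotated])
    have n64: "n \<ge> n2" "n \<ge> 64" using n I(1) unfolding n0_def by auto
    have pert: "\<bar>(\<Sum>j=p..<q. f ((T ^^ j) z) - c) - (\<Sum>j=p..<q. f ((T ^^ j) y) - c)\<bar> \<le> e * real n"
      if "y \<in> X" "z \<in> X" "word n y = word n z" "q \<le> n" for y z p q c
    proof -
      have "\<bar>(\<Sum>j=p..<q. f ((T ^^ j) z) - c) - (\<Sum>j=p..<q. f ((T ^^ j) y) - c)\<bar>
          = \<bar>\<Sum>j=p..<q. f ((T ^^ j) z) - f ((T ^^ j) y)\<bar>"
        unfolding sum_subtractf[symmetric] by simp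
      also have "\<dots> \<le> (\<Sum>j=p..<q. e)"
        by (rule order_trans[OF sum_abs sum_mono]) (use that n64 in \<open>auto intro!: n2\<close>)
      also have "\<dots> = e * real (q - p)" by simp
      also have "\<dots> \<le> e * real n" using e that(4) by (intro mult_left_mono) auto
      finally show ?thesis .
    qed
    have "\<forall>i\<in>I. \<exists>t\<le>K * n + 1. word n ((T ^^ t) (x i)) \<in> right_special n"
      using right_special_visit[OF x] n64 by (auto simp: K_def)
    then obtain \<theta> where \<theta>: "\<And>i. i \<in> I \<Longrightarrow> \<theta> i \<le> K * n + 1"
      "\<And>i. i \<in> I \<Longrightarrow> word n ((T ^^ \<theta> i) (x i)) \<in> right_special n" by metis
    define \<rho> where "\<rho> i = word n ((T ^^ \<theta> i) (x i))" for i
    \<comment> \<open>The word \<open>\<rho> i\<close> occurs along \<open>x i\<close> at a time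
      \<open>\<theta> i\<close> of at most \<open>K * n + 1\<close>, so the window ends before
      \<open>(K + 2) * n\<close>. Any other point with this word differs by \<open>pert\<close>
      only.\<close>
    have pure: "\<bar>\<Sum>j=p..<q. f ((T ^^ j) y) - a i\<bar> \<le> 2 * e * real n"
      if "i \<in> I" "y \<in> X" "word n y = \<rho> i" "p \<le> q" "q \<le> n" for i y p q
    proof -
      have "(\<Sum>j=p..<q. f ((T ^^ j) ((T ^^ \<theta> i) (x i))) - a i)
          = (\<Sum>j=p+\<theta> i..<q+\<theta> i. f ((T ^^ j) (x i)) - a i)"
        unfolding sum.shift_bounds_nat_ivl by (simp add: Tn_add)
      moreover have "q + \<theta> i \<le> (K + 2) * n" using \<theta>(1)[OF that(1)] that(5) n64 by simp
      ultimately have "\<bar>\<Sum>j=p..<q. f ((T ^^ j) ((T ^^ \<theta> i) (x i))) - a i\<bar> \<le> e * real n"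
        using n1[OF that(1) n1n[OF that(1)], of "p + \<theta> i" "q + \<theta> i"] that(4) by simp
      then show ?thesis
        using pert[OF Tn_in[OF x[OF that(1)]] that(2) _ that(5), of "\<theta> i" "a i" p] that(3)
        unfolding \<rho>_def by simp
    qed
    \<comment> \<open>The \<open>K\<close> paths together lose at most \<open>n div 16\<close>
      vertices, less than the \<open>n div 8\<close> that the second branch contributes.\<close>
    define M where "M = n - n div (16 * K)"
    have KM: "K * (n div (16 * K)) \<le> n div 16"
      by (simp add: div_mult2_eq)
    have dle: "n div (16 * K) \<le> n div 16" using K by (intro div_le_mono2) auto
    have M: "M \<le> n" "n div 8 < M" "K * n + 1 < K * M + n div 8"
    proof -
      show "M \<le> n" by (simp add: M_def)
      have d16: "n div (16 * K) \<le> n" by simp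
      have "n div 8 + n div 16 < n" using n64 by linarith
      then show "n div 8 < M" unfolding M_def using dle by linarith
      have "K * M = K * n - K * (n div (16 * K))" by (simp add: M_def diff_mult_distrib2)
      moreover have "K * (n div (16 * K)) \<le> K * n" using d16 by (rule mult_le_mono2)
      moreover have "n div 16 + 1 < n div 8" using n64 by linarith
      ultimately show "K * n + 1 < K * M + n div 8" using KM by linarith
    qed
    have sep: "M \<le> max s t"
      if ij: "i \<in> I" "j \<in> I" "i \<noteq> j" and y: "y \<in> X" "z \<in> X" "word n y = \<rho> i" "word n z = \<rho> j"
        and st: "s \<le> n" "t \<le> n" "word n ((T ^^ s) y) = word n ((T ^^ t) z)" for i j y z s t
    proof (rule ccontr)
      assume "\<not> ?thesis"
      \<comment> \<open>Number of steps for which both points still move inside their original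
        words, so that \<open>pure\<close> controls both sums.\<close>
      define m where "m = n - max s t"
      have m: "s + m \<le> n" "t + m \<le> n" using st by (auto simp: m_def)
      have "n div (16 * K) < m" using \<open>\<not> M \<le> max s t\<close> st by (auto simp: M_def m_def)
      then have "n < m * (16 * K)" using K by (subst (asm) div_less_iff_less_mult) auto
      then have nm: "real n < real m * (16 * real K)"
        by (metis of_nat_less_iff of_nat_mult of_nat_numeral)
      have shift: "(\<Sum>r=s..<s+m. f ((T ^^ r) y) - c) = (\<Sum>r=0..<m. f ((T ^^ r) ((T ^^ s) y)) - c)" for s y c
        using sum.shift_bounds_nat_ivl[of "\<lambda>r. f ((T ^^ r) y) - c" 0 s m] by (simp add: Tn_add add.commute)
      have 1: "\<bar>\<Sum>r=0..<m. f ((T ^^ r) ((T ^^ s) y)) - a i\<bar> \<le> 2 * e * real n"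
        using pure[OF ij(1) y(1,3), of s "s + m"] m(1) by (simp add: shift)
      have 2: "\<bar>\<Sum>r=0..<m. f ((T ^^ r) ((T ^^ t) z)) - a j\<bar> \<le> 2 * e * real n"
        using pure[OF ij(2) y(2,4), of t "t + m"] m(2) by (simp add: shift)
      have 3: "\<bar>(\<Sum>r=0..<m. f ((T ^^ r) ((T ^^ t) z)) - a j) - (\<Sum>r=0..<m. f ((T ^^ r) ((T ^^ s) y)) - a j)\<bar> \<le> e * real n"
        using m by (intro pert Tn_in y st(3)) auto
      have 4: "(\<Sum>r=0..<m. f ((T ^^ r) ((T ^^ s) y)) - a j) - (\<Sum>r=0..<m. f ((T ^^ r) ((T ^^ s) y)) - a i)
          = real m * (a i - a j)"
        unfolding sum_subtractf[symmetric] by simp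
      have "\<bar>real m * (a i - a j)\<bar> \<le> 5 * (e * real n)" using 1 2 3 4 by linarith
      moreover have "real m * D \<le> \<bar>real m * (a i - a j)\<bar>"
        using D[OF ij] by (simp add: abs_mult mult_left_mono)
      moreover have "5 * (e * real n) < 6 * (e * (real m * (16 * real K)))"
      proof -
        have "e * real n < e * (real m * (16 * real K))" using nm e by simp
        moreover have "0 \<le> e * real n" using e by simp
        ultimately show ?thesis by linarith
      qed
      moreover have "6 * (e * (real m * (16 * real K))) = real m * D"
        using K by (simp add: e_def)
      ultimately show False by linarith
    qed
    show "\<exists>M \<rho>. \<rho> ` I \<subseteq> right_special n \<and> M \<le> n \<and> n div 8 < M \<and>
      (k - 1) * n + 1 < (k - 1) * M + n div 8 \<and>
      (\<forall>i\<in>I. \<forall>j\<in>I. i \<noteq> j \<longrightarrow> (\<forall>x\<in>X. \<forall>y\<in>X. word n x = \<rho> i \<longrightarrow> word n y = \<rho> j \<longrightarrow>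
        (\<forall>s\<le>n. \<forall>t\<le>n. word n ((T ^^ s) x) = word n ((T ^^ t) y) \<longrightarrow> M \<le> max s t)))"
    proof (intro exI[of _ M] exI[of _ \<rho>] conjI ballI allI impI)
      show "\<rho> ` I \<subseteq> right_special n" using \<theta>(2) by (auto simp: \<rho>_def)
    qed (use M sep in \<open>auto simp: K_def\<close>)
  qed
qed

text \<open>One continuous function with distinct integrals turns distinct generic measures into
  orbits with distinct averages.\<close>

lemma generic_measures_card_neq:
  assumes k: "k > 2" and I: "finite I" "I \<subseteq> {\<mu>. generic_measure (l k) T \<mu>}"
  shows "card I \<noteq> k - 1"
proof
  assume card: "card I = k - 1"
  have gen: "invariant_measure (l k) T \<mu>" "\<exists>x. generic_point (l k) T \<mu> x" if "\<mu> \<in> I" for \<mu>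
    using I(2) that by (auto simp: generic_measure_def)
  then obtain x where x: "\<And>\<mu>. \<mu> \<in> I \<Longrightarrow> generic_point (l k) T \<mu> (x \<mu>)" by metis
  define V where "V = {f :: real \<Rightarrow> real. continuous_on {0..l k} f}"
  have lim: "(\<lambda>N. (1 / real N) * (\<Sum>n<N. f ((T ^^ n) (x \<mu>)))) \<longlonglongrightarrow> integral\<^sup>L \<mu> f"
    if "\<mu> \<in> I" "f \<in> V" for \<mu> f
    using x[OF that(1)] that(2) by (simp add: generic_point_def V_def)
  have comb: "(\<lambda>x. f x + t * g x) \<in> V" if "f \<in> V" "g \<in> V" for f g t
    using that unfolding V_def by (auto intro!: continuous_intros)
  have "\<exists>f\<in>V. inj_on (\<lambda>\<mu>. integral\<^sup>L \<mu> f) I"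
  proof (rule ex_separating_function[OF I(1)])
    show "(\<lambda>_. 0) \<in> V" by (simp add: V_def)
    fix \<mu> f g and t :: real assume h: "\<mu> \<in> I" "f \<in> V" "g \<in> V"
    \<comment> \<open>Linearity of the integral on continuous functions is read off from the
      averages along the generic point, by uniqueness of limits.\<close>
    have "(\<lambda>N. (1 / real N) * (\<Sum>n<N. f ((T ^^ n) (x \<mu>))) + t * ((1 / real N) * (\<Sum>n<N. g ((T ^^ n) (x \<mu>)))))
        \<longlonglongrightarrow> integral\<^sup>L \<mu> f + t * integral\<^sup>L \<mu> g"
      by (intro tendsto_intros lim h)
    moreover have "(1 / real N) * (\<Sum>n<N. f ((T ^^ n) (x \<mu>))) + t * ((1 / real N) * (\<Sum>n<N. g ((T ^^ n) (x \<mu>))))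
        = (1 / real N) * (\<Sum>n<N. f ((T ^^ n) (x \<mu>)) + t * g ((T ^^ n) (x \<mu>)))" for N
      by (simp add: sum.distrib sum_distrib_left distrib_left mult_ac)
    ultimately show "integral\<^sup>L \<mu> (\<lambda>x. f x + t * g x) = integral\<^sup>L \<mu> f + t * integral\<^sup>L \<mu> g"
      using LIMSEQ_unique[OF lim[OF h(1) comb[OF h(2,3), of t]]] by simp
  next
    fix \<mu> \<nu> assume h: "\<mu> \<in> I" "\<nu> \<in> I" "\<mu> \<noteq> \<nu>"
    show "\<exists>f\<in>V. integral\<^sup>L \<mu> f \<noteq> integral\<^sup>L \<nu> f"
    proof (rule ccontr)
      assume "\<not> ?thesis"
      then have "\<mu> = \<nu>"
        using gen(1)[OF h(1)] gen(1)[OF h(2)] unfolding invariant_measure_def V_def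
        by (intro prob_eqI_continuous[of \<mu> \<nu> "l k"]) auto
      then show False using h(3) by simp
    qed
  qed (rule comb)
  then obtain f where f: "f \<in> V" "inj_on (\<lambda>\<mu>. integral\<^sup>L \<mu> f) I" by blast
  show False
  proof (rule no_separated_averages[OF k I(1) card _ _ lim[OF _ f(1)] f(2)])
    show "x \<mu> \<in> X" if "\<mu> \<in> I" for \<mu> using x[OF that] by (simp add: generic_point_def)
    show "continuous_on {0..l k} f" using f(1) by (simp add: V_def)
  qed
qed

end

theorem theorem1p4:
  fixes k :: nat and \<pi> :: "nat \<Rightarrow> nat" and l :: "nat \<Rightarrow> real"
  assumes "k > 2"
    and "minimal_iet k \<pi> l"
  shows "finite {\<mu>. generic_measure (l k) (iet k \<pi> l) \<mu>} \<and>
         card {\<mu>. generic_measure (l k) (iet k \<pi> l) \<mu>} \<le> k - 2"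
proof (rule ccontr)
  interpret minimal_exchange k \<pi> l by unfold_locales fact
  assume many: "\<not> ?thesis"
  define G where "G = {\<mu>. generic_measure (l k) (iet k \<pi> l) \<mu>}"
  \<comment> \<open>Exactly \<open>k - 1\<close> measures are selected. The infinite case is
    separate because \<open>card\<close> is then 0.\<close>
  have "\<exists>I. I \<subseteq> G \<and> finite I \<and> card I = k - 1"
  proof (cases "finite G")
    case True
    then have "k - 1 \<le> card G" using many unfolding G_def by linarith
    then obtain I where "I \<subseteq> G" "card I = k - 1" "finite I" by (rule obtain_subset_with_card_n)
    then show ?thesis by blast
  next
    case False
    then show ?thesis using infinite_arbitrarily_large[of G "k - 1"] by auto
  qed
  then show False using generic_measures_card_neq[OF assms(1)] unfolding G_def by blast
qed

end
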